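(* Let $M$ be a compact contact manifold with contact form $\theta$ and Reeb vector field $\xi$, and let $\{\cdot,\cdot\}$ be the Jacobi bracket on $C^\infty(M)$ determined by $\theta$. Then the space $C^\infty_b(M)=\{f\in C^\infty(M)\mid \xi\cdot f=0\}$ is a Lie subalgebra of $(C^\infty(M),\{\cdot,\cdot\})$, and the Jacobi bracket on $C^\infty(M)$ restricts to a Poisson bracket on $C^\infty_b(M)$.
   Context: $M$ is a compact manifold of dimension $2n+1$ with a cooriented contact distribution $E=\ker\theta\subset TM$, where $\theta$ is a global contact form, i.e. $\theta\wedge(d\theta)^n$ is nowhere zero. The Reeb field $\xi$ is the unique vector field with $\theta(\xi)=1$ and $\iota(\xi)d\theta=0$. The bundle map $\Lambda^\#:T^*M\to TM$ is determined by: for every $\eta\in T^*M$, $\theta(\Lambda^\#\eta)=0$ and $\iota(\Lambda^\#\eta)d\theta=\eta(\xi)\theta-\eta$. For $f\in C^\infty(M)$ (real-valued), the Hamiltonian vector field is $X_f=\Lambda^\#(df)+f\xi$. The Jacobi bracket is $\{f,g\}=X_f\cdot g-g\,(\xi\cdot f)$; it is a Lie bracket on $C^\infty(M)$. Here $X\cdot f$ denotes the derivative of $f$ along the vector field $X$. A Poisson bracket on a commutative algebra (here $C^\infty_b(M)$ with pointwise multiplication) is a Lie bracket that is a derivation in each argument. *)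

theory Defs
  imports "HOL-Analysis.Analysis" "HOL-Combinatorics.Permutations" "HOL-Library.Function_Algebras"
begin

section \<open>Smooth manifolds\<close>

primrec C_k_on :: "nat \<Rightarrow> 'a::real_normed_vector set \<Rightarrow> ('a \<Rightarrow> 'b::real_normed_vector) \<Rightarrow> bool" where
  "C_k_on 0 S f \<longleftrightarrow> continuous_on S f"
| "C_k_on (Suc k) S f \<longleftrightarrow> (\<forall>x\<in>S. f differentiable at x) \<and>
     (\<forall>v. C_k_on k S (\<lambda>x. frechet_derivative f (at x) v))"

text \<open>Only used on open sets \<open>S\<close>.\<close>

definition smooth_on :: "'a::real_normed_vector set \<Rightarrow> ('a \<Rightarrow> 'b::real_normed_vector) \<Rightarrow> bool" where
  "smooth_on S f \<longleftrightarrow> (\<forall>k. C_k_on k S f)"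

text \<open>The manifold is the whole type \<open>'a\<close>. A chart is a domain together with a coordinate map;
  the values of the map outside its domain are irrelevant.\<close>

type_synonym ('a, 'e) chart = "'a set \<times> ('a \<Rightarrow> 'e)"

abbreviation chart_dom :: "('a, 'e) chart \<Rightarrow> 'a set" where
  "chart_dom \<equiv> fst"

abbreviation chart_map :: "('a, 'e) chart \<Rightarrow> 'a \<Rightarrow> 'e" where
  "chart_map \<equiv> snd"

definition chart_image :: "('a, 'e) chart \<Rightarrow> 'e set" where
  "chart_image c = chart_map c ` chart_dom c"

definition chart_inv :: "('a, 'e) chart \<Rightarrow> 'e \<Rightarrow> 'a" where
  "chart_inv c = inv_into (chart_dom c) (chart_map c)"

definition is_chart :: "('a::topological_space, 'e::euclidean_space) chart \<Rightarrow> bool" where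
  "is_chart c \<longleftrightarrow> open (chart_dom c) \<and> open (chart_image c) \<and>
     homeomorphism (chart_dom c) (chart_image c) (chart_map c) (chart_inv c)"

definition transition :: "('a, 'e) chart \<Rightarrow> ('a, 'e) chart \<Rightarrow> 'e \<Rightarrow> 'e" where
  "transition c d = chart_map d \<circ> chart_inv c"

definition smooth_atlas :: "('a::topological_space, 'e::euclidean_space) chart set \<Rightarrow> bool" where
  "smooth_atlas A \<longleftrightarrow> (\<forall>c\<in>A. is_chart c) \<and> (\<Union>c\<in>A. chart_dom c) = UNIV \<and>
     (\<forall>c\<in>A. \<forall>d\<in>A. smooth_on (chart_map c ` (chart_dom c \<inter> chart_dom d)) (transition c d))"

definition charts_at :: "('a, 'e) chart set \<Rightarrow> 'a \<Rightarrow> ('a, 'e) chart set" where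
  "charts_at A p = {c \<in> A. p \<in> chart_dom c}"

definition chart_at :: "('a, 'e) chart set \<Rightarrow> 'a \<Rightarrow> ('a, 'e) chart" where
  "chart_at A p = (SOME c. c \<in> charts_at A p)"

definition smooth_functions :: "('a, 'e::euclidean_space) chart set \<Rightarrow> ('a \<Rightarrow> real) set" where
  "smooth_functions A = {f. \<forall>c\<in>A. smooth_on (chart_image c) (f \<circ> chart_inv c)}"

section \<open>Tangent vectors and differential forms\<close>

text \<open>A tangent vector at \<open>p\<close> is given by its coordinate vectors in all charts around \<open>p\<close>, which
  correspond to each other under the derivatives of the transition maps. The coordinate vector is
  set to \<open>0\<close> for all other charts, so that the map sending a tangent vector to its
  coordinate vector in any one chart around \<open>p\<close> is a linear isomorphism.\<close>

type_synonym ('a, 'e) tvec = "('a, 'e) chart \<Rightarrow> 'e"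

definition tangent_space :: "('a, 'e::euclidean_space) chart set \<Rightarrow> 'a \<Rightarrow> ('a, 'e) tvec set" where
  "tangent_space A p = {v.
     (\<forall>c\<in>charts_at A p. \<forall>d\<in>charts_at A p.
        v d = frechet_derivative (transition c d) (at (chart_map c p)) (v c)) \<and>
     (\<forall>c. c \<notin> charts_at A p \<longrightarrow> v c = 0)}"

abbreviation tscale :: "real \<Rightarrow> ('a, 'e::euclidean_space) tvec \<Rightarrow> ('a, 'e) tvec" where
  "tscale r v \<equiv> (\<lambda>c. r *\<^sub>R v c)"

text \<open>The tangent vector at \<open>p\<close> with coordinate vector \<open>e\<close> in the chart \<open>c\<close>.\<close>

definition coord_vec :: "('a, 'e::euclidean_space) chart set \<Rightarrow> ('a, 'e) chart \<Rightarrow> 'a \<Rightarrow> 'e \<Rightarrow> ('a, 'e) tvec" where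
  "coord_vec A c p e = (\<lambda>d. if d \<in> charts_at A p
     then frechet_derivative (transition c d) (at (chart_map c p)) e else 0)"

definition vector_field :: "('a, 'e::euclidean_space) chart set \<Rightarrow> ('a \<Rightarrow> ('a, 'e) tvec) \<Rightarrow> bool" where
  "vector_field A X \<longleftrightarrow> (\<forall>p. X p \<in> tangent_space A p) \<and>
     (\<forall>c\<in>A. smooth_on (chart_image c) (\<lambda>x. X (chart_inv c x) c))"

text \<open>The derivative of \<open>f\<close> along a tangent vector \<open>v\<close> at \<open>p\<close>, computed in a chart around \<open>p\<close>
  (the result does not depend on the chart).\<close>

definition dir_deriv :: "('a, 'e::euclidean_space) chart set \<Rightarrow> 'a \<Rightarrow> ('a, 'e) tvec \<Rightarrow> ('a \<Rightarrow> real) \<Rightarrow> real" where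
  "dir_deriv A p v f = (let c = chart_at A p in
     frechet_derivative (f \<circ> chart_inv c) (at (chart_map c p)) (v c))"

definition differential :: "('a, 'e::euclidean_space) chart set \<Rightarrow> ('a \<Rightarrow> real) \<Rightarrow> 'a \<Rightarrow> ('a, 'e) tvec \<Rightarrow> real" where
  "differential A f p = (\<lambda>v. dir_deriv A p v f)"

text \<open>Covectors and forms at \<open>p\<close> are functions on all of \<open>('a, 'e) tvec\<close>, of which only the
  values on the tangent space at \<open>p\<close> are relevant.\<close>

definition cotangent :: "('a, 'e::euclidean_space) chart set \<Rightarrow> 'a \<Rightarrow> (('a, 'e) tvec \<Rightarrow> real) \<Rightarrow> bool" where
  "cotangent A p \<eta> \<longleftrightarrow>
     (\<forall>v\<in>tangent_space A p. \<forall>w\<in>tangent_space A p. \<eta> (v + w) = \<eta> v + \<eta> w) \<and>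
     (\<forall>r. \<forall>v\<in>tangent_space A p. \<eta> (tscale r v) = r * \<eta> v)"

definition local_form :: "('a, 'e::euclidean_space) chart set \<Rightarrow> ('a \<Rightarrow> ('a, 'e) tvec \<Rightarrow> real)
    \<Rightarrow> ('a, 'e) chart \<Rightarrow> 'e \<Rightarrow> 'e \<Rightarrow> real" where
  "local_form A \<theta> c x e = \<theta> (chart_inv c x) (coord_vec A c (chart_inv c x) e)"

definition one_form :: "('a, 'e::euclidean_space) chart set \<Rightarrow> ('a \<Rightarrow> ('a, 'e) tvec \<Rightarrow> real) \<Rightarrow> bool" where
  "one_form A \<theta> \<longleftrightarrow> (\<forall>p. cotangent A p (\<theta> p)) \<and>
     (\<forall>c\<in>A. \<forall>e. smooth_on (chart_image c) (\<lambda>x. local_form A \<theta> c x e))"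

text \<open>In coordinates, \<open>d\<theta>(v, w)\<close> is the derivative of \<open>\<theta>(w)\<close> along \<open>v\<close> minus the derivative of \<open>\<theta>(v)\<close>
  along \<open>w\<close> for constant \<open>v\<close> and \<open>w\<close>. In this normalisation
  \<open>d\<theta>(X, Y) = X \<cdot> \<theta>(Y) - Y \<cdot> \<theta>(X) - \<theta>([X, Y])\<close>.\<close>

definition ext_deriv :: "('a, 'e::euclidean_space) chart set \<Rightarrow> ('a \<Rightarrow> ('a, 'e) tvec \<Rightarrow> real)
    \<Rightarrow> 'a \<Rightarrow> ('a, 'e) tvec \<Rightarrow> ('a, 'e) tvec \<Rightarrow> real" where
  "ext_deriv A \<theta> p v w = (let c = chart_at A p in
     frechet_derivative (\<lambda>x. local_form A \<theta> c x (w c)) (at (chart_map c p)) (v c)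
   - frechet_derivative (\<lambda>x. local_form A \<theta> c x (v c)) (at (chart_map c p)) (w c))"

text \<open>A \<open>k\<close>-form on a vector space is represented as a function of a sequence of vectors that uses
  only the entries with indices \<open>0, \<dots>, k - 1\<close>.\<close>

definition wedge :: "nat \<Rightarrow> nat \<Rightarrow> ((nat \<Rightarrow> 'v) \<Rightarrow> real) \<Rightarrow> ((nat \<Rightarrow> 'v) \<Rightarrow> real) \<Rightarrow> (nat \<Rightarrow> 'v) \<Rightarrow> real" where
  "wedge k l \<alpha> \<beta> v = (\<Sum>\<sigma> | \<sigma> permutes {..<k + l}.
     of_int (sign \<sigma>) * \<alpha> (\<lambda>i. v (\<sigma> i)) * \<beta> (\<lambda>i. v (\<sigma> (k + i)))) / (fact k * fact l)"

primrec wedge_power :: "nat \<Rightarrow> ((nat \<Rightarrow> 'v) \<Rightarrow> real) \<Rightarrow> nat \<Rightarrow> (nat \<Rightarrow> 'v) \<Rightarrow> real" where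
  "wedge_power k \<alpha> 0 = (\<lambda>v. 1)"
| "wedge_power k \<alpha> (Suc n) = wedge k (n * k) \<alpha> (wedge_power k \<alpha> n)"

section \<open>Contact forms and the Jacobi bracket\<close>

definition contact_form :: "nat \<Rightarrow> ('a, 'e::euclidean_space) chart set
    \<Rightarrow> ('a \<Rightarrow> ('a, 'e) tvec \<Rightarrow> real) \<Rightarrow> bool" where
  "contact_form n A \<theta> \<longleftrightarrow> one_form A \<theta> \<and>
     (\<forall>p. \<exists>v. (\<forall>i<2 * n + 1. v i \<in> tangent_space A p) \<and>
        wedge 1 (2 * n) (\<lambda>u. \<theta> p (u 0))
          (wedge_power 2 (\<lambda>u. ext_deriv A \<theta> p (u 0) (u 1)) n) v \<noteq> 0)"

definition reeb_field :: "('a, 'e::euclidean_space) chart set \<Rightarrow> ('a \<Rightarrow> ('a, 'e) tvec \<Rightarrow> real)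
    \<Rightarrow> 'a \<Rightarrow> ('a, 'e) tvec" where
  "reeb_field A \<theta> = (THE \<xi>. vector_field A \<xi> \<and>
     (\<forall>p. \<theta> p (\<xi> p) = 1 \<and> (\<forall>v\<in>tangent_space A p. ext_deriv A \<theta> p (\<xi> p) v = 0)))"

text \<open>The bundle map \<open>\<Lambda>\<^sup>#\<close> from the cotangent to the tangent bundle, applied to a covector \<open>\<eta>\<close> at \<open>p\<close>.\<close>

definition Lambda_sharp :: "('a, 'e::euclidean_space) chart set \<Rightarrow> ('a \<Rightarrow> ('a, 'e) tvec \<Rightarrow> real)
    \<Rightarrow> 'a \<Rightarrow> (('a, 'e) tvec \<Rightarrow> real) \<Rightarrow> ('a, 'e) tvec" where
  "Lambda_sharp A \<theta> p \<eta> = (THE w. w \<in> tangent_space A p \<and> \<theta> p w = 0 \<and>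
     (\<forall>v\<in>tangent_space A p. ext_deriv A \<theta> p w v = \<eta> (reeb_field A \<theta> p) * \<theta> p v - \<eta> v))"

definition hamiltonian_field :: "('a, 'e::euclidean_space) chart set \<Rightarrow> ('a \<Rightarrow> ('a, 'e) tvec \<Rightarrow> real)
    \<Rightarrow> ('a \<Rightarrow> real) \<Rightarrow> 'a \<Rightarrow> ('a, 'e) tvec" where
  "hamiltonian_field A \<theta> f p =
     Lambda_sharp A \<theta> p (differential A f p) + tscale (f p) (reeb_field A \<theta> p)"

definition jacobi_bracket :: "('a, 'e::euclidean_space) chart set \<Rightarrow> ('a \<Rightarrow> ('a, 'e) tvec \<Rightarrow> real)
    \<Rightarrow> ('a \<Rightarrow> real) \<Rightarrow> ('a \<Rightarrow> real) \<Rightarrow> 'a \<Rightarrow> real" where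
  "jacobi_bracket A \<theta> f g = (\<lambda>p. dir_deriv A p (hamiltonian_field A \<theta> f p) g
     - g p * dir_deriv A p (reeb_field A \<theta> p) f)"

definition basic_functions :: "('a, 'e::euclidean_space) chart set \<Rightarrow> ('a \<Rightarrow> ('a, 'e) tvec \<Rightarrow> real)
    \<Rightarrow> ('a \<Rightarrow> real) set" where
  "basic_functions A \<theta> =
     {f \<in> smooth_functions A. \<forall>p. dir_deriv A p (reeb_field A \<theta> p) f = 0}"

section \<open>Lie and Poisson brackets on spaces of functions\<close>

abbreviation fscale :: "real \<Rightarrow> ('a \<Rightarrow> real) \<Rightarrow> 'a \<Rightarrow> real" where
  "fscale r f \<equiv> (\<lambda>x. r * f x)"

abbreviation function_space :: "('a \<Rightarrow> real) set \<Rightarrow> bool" where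
  "function_space \<equiv> module.subspace fscale"

definition lie_algebra :: "('a \<Rightarrow> real) set \<Rightarrow> (('a \<Rightarrow> real) \<Rightarrow> ('a \<Rightarrow> real) \<Rightarrow> 'a \<Rightarrow> real) \<Rightarrow> bool" where
  "lie_algebra V br \<longleftrightarrow> function_space V \<and>
     (\<forall>f\<in>V. \<forall>g\<in>V. br f g \<in> V) \<and>
     (\<forall>f\<in>V. \<forall>g\<in>V. \<forall>h\<in>V. br (f + g) h = br f h + br g h \<and> br h (f + g) = br h f + br h g) \<and>
     (\<forall>r. \<forall>f\<in>V. \<forall>g\<in>V. br (fscale r f) g = fscale r (br f g) \<and> br f (fscale r g) = fscale r (br f g)) \<and>
     (\<forall>f\<in>V. br f f = 0) \<and>
     (\<forall>f\<in>V. \<forall>g\<in>V. \<forall>h\<in>V. br f (br g h) + br g (br h f) + br h (br f g) = 0)"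

definition lie_subalgebra :: "('a \<Rightarrow> real) set \<Rightarrow> ('a \<Rightarrow> real) set
    \<Rightarrow> (('a \<Rightarrow> real) \<Rightarrow> ('a \<Rightarrow> real) \<Rightarrow> 'a \<Rightarrow> real) \<Rightarrow> bool" where
  "lie_subalgebra S V br \<longleftrightarrow> lie_algebra V br \<and> S \<subseteq> V \<and> function_space S \<and>
     (\<forall>f\<in>S. \<forall>g\<in>S. br f g \<in> S)"

text \<open>\<open>V\<close> is a unital algebra of functions under pointwise multiplication.\<close>

definition function_algebra :: "('a \<Rightarrow> real) set \<Rightarrow> bool" where
  "function_algebra V \<longleftrightarrow> function_space V \<and> 1 \<in> V \<and> (\<forall>f\<in>V. \<forall>g\<in>V. f * g \<in> V)"

definition poisson_bracket_on :: "('a \<Rightarrow> real) set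
    \<Rightarrow> (('a \<Rightarrow> real) \<Rightarrow> ('a \<Rightarrow> real) \<Rightarrow> 'a \<Rightarrow> real) \<Rightarrow> bool" where
  "poisson_bracket_on V br \<longleftrightarrow> function_algebra V \<and> lie_algebra V br \<and>
     (\<forall>f\<in>V. \<forall>g\<in>V. \<forall>h\<in>V. br f (g * h) = br f g * h + g * br f h \<and>
                           br (f * g) h = br f h * g + f * br g h)"

end

theory Submission
  imports Defs
begin

text \<open>The Lie algebra structure comes from \<open>d(d\<theta>) = 0\<close>. The Hamiltonian vector field \<open>X\<^sub>f\<close> satisfies
  \<open>\<theta>(X\<^sub>f) = f\<close> and \<open>d\<theta>(X\<^sub>f, \<cdot>) = (\<xi>f) \<theta> - df\<close>. Inserting \<open>X\<^sub>g\<close> into the second equation yields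
  \<open>{f, g} = f \<xi>g - g \<xi>f + d\<theta>(X\<^sub>f, X\<^sub>g)\<close>, so the bracket is antisymmetric, and comparing with Cartan's
  formula for \<open>d\<theta>\<close> yields \<open>{f, g} = \<theta>([X\<^sub>f, X\<^sub>g])\<close>. When Cartan's formula for \<open>d(d\<theta>)\<close> is evaluated on
  \<open>X\<^sub>f\<close>, \<open>X\<^sub>g\<close>, \<open>X\<^sub>h\<close> and rewritten with these equations, all terms cancel except the cyclic sum of
  the double brackets (\<open>hamiltonian_data.jacobi\<close>). All of this is a computation in one chart; it rests on
  the symmetry of second derivatives (\<open>second_derivative_symmetric\<close>).

  For the brackets to be well defined and smooth, \<open>\<xi>\<close> and \<open>X\<^sub>f\<close> have to exist, to be unique, and to be
  smooth. The contact condition implies that \<open>\<theta>\<close> and \<open>d\<theta>\<close> have no common kernel at any point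
  (\<open>contact_condition_nondegenerate\<close>), which means that the bilinear form \<open>d\<theta> + \<theta> \<otimes> \<theta>\<close> is nondegenerate. Both fields
  solve linear systems with this matrix, so they are smooth by Cramer's rule (\<open>smooth_on_solution\<close>); the
  Reeb field exists because an alternating form on an odd-dimensional space has a kernel. In order to
  work in any chart, one checks that directional and exterior derivatives do not depend on the chart
  (\<open>dir_deriv_chart\<close>, \<open>ext_deriv_chart\<close>).

  The statements on basic functions are then formal. Since \<open>{1, f} = \<xi>f\<close>, the Jacobi identity for
  \<open>1\<close>, \<open>f\<close>, \<open>g\<close> shows that \<open>\<xi>\<close> annihilates \<open>{f, g}\<close> when it annihilates \<open>f\<close> and \<open>g\<close>. For such functions
  \<open>{f, g} = X\<^sub>f g\<close> is a derivation in \<open>g\<close>, and by antisymmetry also in \<open>f\<close>.\<close>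

section \<open>Calculus of smooth functions\<close>

abbreviation D :: "('a::real_normed_vector \<Rightarrow> 'b::real_normed_vector) \<Rightarrow> 'a \<Rightarrow> 'a \<Rightarrow> 'b" where
  "D f x \<equiv> frechet_derivative f (at x)"

lemma D_eqI: "(f has_derivative f') (at x) \<Longrightarrow> D f x = f'"
  by (metis frechet_derivative_at)

lemma has_derivative_D: "f differentiable at x \<Longrightarrow> (f has_derivative D f x) (at x)"
  by (simp add: frechet_derivative_works)

lemma has_derivative_cong_open:
  "open S \<Longrightarrow> x \<in> S \<Longrightarrow> (\<And>y. y \<in> S \<Longrightarrow> f y = g y) \<Longrightarrow>
    (f has_derivative f') (at x) \<longleftrightarrow> (g has_derivative f') (at x)"
  by (metis has_derivative_transform_within_open)

lemma differentiable_cong_open: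
  "open S \<Longrightarrow> x \<in> S \<Longrightarrow> (\<And>y. y \<in> S \<Longrightarrow> f y = g y) \<Longrightarrow>
    f differentiable at x \<longleftrightarrow> g differentiable at x"
  unfolding differentiable_def using has_derivative_cong_open by metis

lemma D_cong_open:
  "open S \<Longrightarrow> x \<in> S \<Longrightarrow> (\<And>y. y \<in> S \<Longrightarrow> f y = g y) \<Longrightarrow> D f x = D g x"
  unfolding frechet_derivative_def using has_derivative_cong_open by metis

lemma C_k_on_cong:
  assumes "open S" "\<And>y. y \<in> S \<Longrightarrow> f y = g y"
  shows "C_k_on k S f \<longleftrightarrow> C_k_on k S g"
  using assms(2)
proof (induction k arbitrary: f g)
  case 0
  then show ?case by (simp cong: continuous_on_cong)
next
  case (Suc k)
  have "C_k_on k S (\<lambda>x. D f x v) \<longleftrightarrow> C_k_on k S (\<lambda>x. D g x v)" for v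
    by (rule Suc.IH) (metis D_cong_open[OF assms(1)] Suc.prems)
  moreover have "(\<forall>x\<in>S. f differentiable at x) \<longleftrightarrow> (\<forall>x\<in>S. g differentiable at x)"
    using differentiable_cong_open[OF assms(1)] Suc.prems by metis
  ultimately show ?case by simp
qed

text \<open>Without this step the product rule would not close up under induction: the derivative of a product
  involves the factors themselves, which must be known to be one order less regular.\<close>

lemma C_k_on_SucD: "C_k_on (Suc k) S f \<Longrightarrow> C_k_on k S f"
proof (induction k arbitrary: f)
  case 0
  then show ?case
    by (auto intro!: continuous_at_imp_continuous_on differentiable_imp_continuous_within)
qed auto

lemma C_k_on_bounded_linear:
  assumes "open S" "bounded_linear h"
  shows "C_k_on k S f \<Longrightarrow> C_k_on k S (\<lambda>x. h (f x))"
proof (induction k arbitrary: f)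
  case 0
  then show ?case using assms(2) by (simp add: linear_continuous_on_compose bounded_linear.continuous_on)
next
  case (Suc k)
  have 1: "((\<lambda>x. h (f x)) has_derivative (\<lambda>v. h (D f x v))) (at x)" if "x \<in> S" for x
    using Suc.prems that by (intro bounded_linear.has_derivative[OF assms(2)]) (auto simp: has_derivative_D)
  have "C_k_on k S (\<lambda>x. D (\<lambda>x. h (f x)) x v)" for v
  proof -
    have "C_k_on k S (\<lambda>x. h (D f x v))" using Suc by simp
    then show ?thesis
      by (subst C_k_on_cong[OF assms(1)]) (auto simp: D_eqI[OF 1])
  qed
  then show ?case using 1 by (auto simp: differentiable_def)
qed

lemma C_k_on_add:
  assumes "open S"
  shows "C_k_on k S f \<Longrightarrow> C_k_on k S g \<Longrightarrow> C_k_on k S (\<lambda>x. f x + g x)"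
proof (induction k arbitrary: f g)
  case 0
  then show ?case by (simp add: continuous_on_add)
next
  case (Suc k)
  have 1: "((\<lambda>x. f x + g x) has_derivative (\<lambda>v. D f x v + D g x v)) (at x)" if "x \<in> S" for x
    using Suc.prems that by (intro has_derivative_add) (auto simp: has_derivative_D)
  have "C_k_on k S (\<lambda>x. D (\<lambda>x. f x + g x) x v)" for v
  proof -
    have "C_k_on k S (\<lambda>x. D f x v + D g x v)" using Suc by simp
    then show ?thesis
      by (subst C_k_on_cong[OF assms]) (auto simp: D_eqI[OF 1])
  qed
  then show ?case using 1 by (auto simp: differentiable_def)
qed

lemma C_k_on_mult:
  fixes f g :: "'a::real_normed_vector \<Rightarrow> real"
  assumes "open S"
  shows "C_k_on k S f \<Longrightarrow> C_k_on k S g \<Longrightarrow> C_k_on k S (\<lambda>x. f x * g x)"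
proof (induction k arbitrary: f g)
  case 0
  then show ?case by (simp add: continuous_on_mult)
next
  case (Suc k)
  have 1: "((\<lambda>x. f x * g x) has_derivative (\<lambda>v. f x * D g x v + D f x v * g x)) (at x)" if "x \<in> S" for x
    using Suc.prems that by (intro has_derivative_mult) (auto simp: has_derivative_D)
  have "C_k_on k S (\<lambda>x. D (\<lambda>x. f x * g x) x v)" for v
  proof -
    have "C_k_on k S (\<lambda>x. f x * D g x v + D f x v * g x)"
    proof (intro C_k_on_add[OF assms] Suc.IH)
      show "C_k_on k S f" "C_k_on k S g" using Suc.prems[THEN C_k_on_SucD] by simp_all
      show "C_k_on k S (\<lambda>x. D f x v)" "C_k_on k S (\<lambda>x. D g x v)" using Suc.prems by simp_all
    qed
    then show ?thesis
      by (subst C_k_on_cong[OF assms]) (auto simp: D_eqI[OF 1])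
  qed
  then show ?case using 1 by (auto simp: differentiable_def)
qed

lemma C_k_on_const: "C_k_on k S (\<lambda>x. c)"
  by (induction k arbitrary: c) auto

lemma C_k_on_inverse:
  fixes f :: "'a::real_normed_vector \<Rightarrow> real"
  assumes "open S" "\<And>x. x \<in> S \<Longrightarrow> f x \<noteq> 0"
  shows "C_k_on k S f \<Longrightarrow> C_k_on k S (\<lambda>x. inverse (f x))"
proof (induction k)
  case 0
  then show ?case using assms by (simp add: continuous_on_inverse)
next
  case (Suc k)
  have 1: "((\<lambda>x. inverse (f x)) has_derivative (\<lambda>v. - (inverse (f x) * D f x v * inverse (f x)))) (at x)"
    if "x \<in> S" for x
    using Deriv.has_derivative_inverse[OF assms(2)[OF that] has_derivative_D[of f]] Suc.prems that by simp
  have "C_k_on k S (\<lambda>x. D (\<lambda>x. inverse (f x)) x v)" for v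
  proof -
    have i: "C_k_on k S (\<lambda>x. inverse (f x))" using Suc.IH[OF C_k_on_SucD[OF Suc.prems]] .
    have "C_k_on k S (\<lambda>x. D f x v)" using Suc.prems by simp
    then have "C_k_on k S (\<lambda>x. - (inverse (f x) * D f x v * inverse (f x)))"
      using i by (intro C_k_on_bounded_linear[OF assms(1), of uminus] C_k_on_mult[OF assms(1)])
        (auto intro: bounded_linear_minus)
    then show ?thesis
      by (subst C_k_on_cong[OF assms(1)]) (auto simp: D_eqI[OF 1])
  qed
  then show ?case using 1 by (auto simp: differentiable_def)
qed

lemma smooth_on_cong:
  "open S \<Longrightarrow> (\<And>y. y \<in> S \<Longrightarrow> f y = g y) \<Longrightarrow> smooth_on S f \<longleftrightarrow> smooth_on S g"
  unfolding smooth_on_def using C_k_on_cong by metis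

lemma smooth_on_const: "smooth_on S (\<lambda>x. c)"
  by (simp add: smooth_on_def C_k_on_const)

lemma smooth_on_add:
  "open S \<Longrightarrow> smooth_on S f \<Longrightarrow> smooth_on S g \<Longrightarrow> smooth_on S (\<lambda>x. f x + g x)"
  by (simp add: smooth_on_def C_k_on_add)

lemma smooth_on_bounded_linear:
  "open S \<Longrightarrow> bounded_linear h \<Longrightarrow> smooth_on S f \<Longrightarrow> smooth_on S (\<lambda>x. h (f x))"
  by (simp add: smooth_on_def C_k_on_bounded_linear)

lemma smooth_on_minus: "open S \<Longrightarrow> smooth_on S f \<Longrightarrow> smooth_on S (\<lambda>x. - f x)"
  using smooth_on_bounded_linear[of S uminus f] by (simp add: bounded_linear_minus bounded_linear_ident)

lemma smooth_on_diff:
  "open S \<Longrightarrow> smooth_on S f \<Longrightarrow> smooth_on S g \<Longrightarrow> smooth_on S (\<lambda>x. f x - g x)"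
  using smooth_on_add[of S f "\<lambda>x. - g x"] by (simp add: smooth_on_minus)

lemma smooth_on_mult:
  fixes f g :: "'a::real_normed_vector \<Rightarrow> real"
  shows "open S \<Longrightarrow> smooth_on S f \<Longrightarrow> smooth_on S g \<Longrightarrow> smooth_on S (\<lambda>x. f x * g x)"
  by (simp add: smooth_on_def C_k_on_mult)

lemma smooth_on_divide:
  fixes f g :: "'a::real_normed_vector \<Rightarrow> real"
  assumes "open S" "smooth_on S f" "smooth_on S g" "\<And>x. x \<in> S \<Longrightarrow> g x \<noteq> 0"
  shows "smooth_on S (\<lambda>x. f x / g x)"
  using assms C_k_on_mult[of S _ f "\<lambda>x. inverse (g x)"] C_k_on_inverse[of S g]
  by (simp add: smooth_on_def divide_inverse)

lemma smooth_on_sum: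
  "open S \<Longrightarrow> (\<And>i. i \<in> I \<Longrightarrow> smooth_on S (f i)) \<Longrightarrow> smooth_on S (\<lambda>x. \<Sum>i\<in>I. f i x)"
  by (induction I rule: infinite_finite_induct) (auto intro: smooth_on_const smooth_on_add)

lemma smooth_on_prod:
  fixes f :: "'i \<Rightarrow> 'a::real_normed_vector \<Rightarrow> real"
  shows "open S \<Longrightarrow> (\<And>i. i \<in> I \<Longrightarrow> smooth_on S (f i)) \<Longrightarrow> smooth_on S (\<lambda>x. \<Prod>i\<in>I. f i x)"
  by (induction I rule: infinite_finite_induct) (auto intro: smooth_on_const smooth_on_mult)

text \<open>Vector fields are found as solutions of linear systems, so their smoothness is obtained one
  coordinate at a time.\<close>

lemma smooth_on_componentwise:
  fixes f :: "'a::real_normed_vector \<Rightarrow> 'b::euclidean_space"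
  assumes "open S" "\<And>b. b \<in> Basis \<Longrightarrow> smooth_on S (\<lambda>x. f x \<bullet> b)"
  shows "smooth_on S f"
proof -
  have "smooth_on S (\<lambda>x. \<Sum>b\<in>Basis. (f x \<bullet> b) *\<^sub>R b)"
    using assms by (intro smooth_on_sum smooth_on_bounded_linear[where h = "\<lambda>r. r *\<^sub>R _"])
      (auto intro: bounded_linear_scaleR_left)
  then show ?thesis by (simp add: euclidean_representation)
qed

lemma smooth_on_inner_left:
  "open S \<Longrightarrow> smooth_on S f \<Longrightarrow> smooth_on S (\<lambda>x. f x \<bullet> b)"
  by (rule smooth_on_bounded_linear[of S "\<lambda>y. y \<bullet> b"]) (auto intro: bounded_linear_inner_left)

lemma smooth_on_imp_differentiable: "smooth_on S f \<Longrightarrow> x \<in> S \<Longrightarrow> f differentiable at x"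
  unfolding smooth_on_def by (metis C_k_on.simps(2))

lemma smooth_on_D: "smooth_on S f \<Longrightarrow> smooth_on S (\<lambda>x. D f x v)"
  unfolding smooth_on_def by (metis C_k_on.simps(2))

lemma smooth_on_imp_continuous: "smooth_on S f \<Longrightarrow> continuous_on S f"
  unfolding smooth_on_def by (metis C_k_on.simps(1))

text \<open>The product rule for evaluating a point-dependent linear map on a point-dependent vector. Smoothness
  of forms is only given for constant arguments; expanding the vector in a basis reduces the claim to
  the product rule for real functions.\<close>

lemma has_derivative_apply_field:
  fixes L :: "'a::real_normed_vector \<Rightarrow> 'b::euclidean_space \<Rightarrow> real"
  assumes S: "open S" "x \<in> S" and lin: "\<And>y. y \<in> S \<Longrightarrow> linear (L y)"
    and L: "\<And>e. (\<lambda>y. L y e) differentiable at x" and Y: "Y differentiable at x"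
  shows "((\<lambda>y. L y (Y y)) has_derivative (\<lambda>v. D (\<lambda>y. L y (Y x)) x v + L x (D Y x v))) (at x)"
proof -
  have expand: "L y e = (\<Sum>b\<in>Basis. (e \<bullet> b) * L y b)" if "y \<in> S" for y e
    by (subst (1) euclidean_representation[of e, symmetric])
      (use lin[OF that] in \<open>simp add: linear_sum linear_cmul\<close>)
  have dY: "((\<lambda>y. Y y \<bullet> b) has_derivative (\<lambda>v. D Y x v \<bullet> b)) (at x)" for b
    using has_derivative_D[OF Y] by (rule has_derivative_inner_left)
  have DL: "D (\<lambda>y. L y e) x v = (\<Sum>b\<in>Basis. (e \<bullet> b) * D (\<lambda>y. L y b) x v)" for e v
  proof -
    have "((\<lambda>y. \<Sum>b\<in>Basis. (e \<bullet> b) * L y b) has_derivative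
        (\<lambda>v. \<Sum>b\<in>Basis. (e \<bullet> b) * D (\<lambda>y. L y b) x v)) (at x)"
      by (intro has_derivative_sum has_derivative_mult_right has_derivative_D L)
    then have "((\<lambda>y. L y e) has_derivative (\<lambda>v. \<Sum>b\<in>Basis. (e \<bullet> b) * D (\<lambda>y. L y b) x v)) (at x)"
      by (subst has_derivative_cong_open[OF S]) (auto simp: expand)
    then show ?thesis by (simp add: D_eqI)
  qed
  have "((\<lambda>y. \<Sum>b\<in>Basis. (Y y \<bullet> b) * L y b) has_derivative
      (\<lambda>v. \<Sum>b\<in>Basis. (Y x \<bullet> b) * D (\<lambda>y. L y b) x v + (D Y x v \<bullet> b) * L x b)) (at x)"
    by (intro has_derivative_sum has_derivative_mult dY has_derivative_D L)
  then have "((\<lambda>y. \<Sum>b\<in>Basis. (Y y \<bullet> b) * L y b) has_derivative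
      (\<lambda>v. D (\<lambda>y. L y (Y x)) x v + L x (D Y x v))) (at x)"
    by (simp add: sum.distrib DL[of "Y x"] expand[OF S(2), of "D Y x _"])
  then show ?thesis
    by (subst has_derivative_cong_open[OF S]) (auto simp: expand)
qed

lemma smooth_on_apply_field:
  fixes L :: "'a::real_normed_vector \<Rightarrow> 'b::euclidean_space \<Rightarrow> real"
  assumes S: "open S" and lin: "\<And>y. y \<in> S \<Longrightarrow> linear (L y)"
    and L: "\<And>e. smooth_on S (\<lambda>y. L y e)" and Y: "smooth_on S Y"
  shows "smooth_on S (\<lambda>y. L y (Y y))"
proof -
  have "L y (Y y) = (\<Sum>b\<in>Basis. (Y y \<bullet> b) * L y b)" if "y \<in> S" for y
    by (subst (1) euclidean_representation[of "Y y", symmetric])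
      (use lin[OF that] in \<open>simp add: linear_sum linear_cmul\<close>)
  moreover have "smooth_on S (\<lambda>y. \<Sum>b\<in>Basis. (Y y \<bullet> b) * L y b)"
    by (intro smooth_on_sum smooth_on_mult smooth_on_inner_left S L Y)
  ultimately show ?thesis by (subst smooth_on_cong[OF S])
qed

lemma linear_D: "f differentiable at x \<Longrightarrow> linear (D f x)"
  by (rule linear_frechet_derivative)

text \<open>The mean value theorem is applied twice: first along \<open>u\<close> to \<open>f(\<cdot> + t v) - f(\<cdot>)\<close>, then along \<open>v\<close> to
  the derivative of \<open>f\<close> in direction \<open>u\<close>.\<close>

lemma second_difference_mean_value:
  fixes f :: "'a::real_normed_vector \<Rightarrow> real"
  assumes f: "\<And>y. y \<in> ball x r \<Longrightarrow> f differentiable at y"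
    and Df: "\<And>y. y \<in> ball x r \<Longrightarrow> (\<lambda>z. D f z u) differentiable at y"
    and t: "t > 0" "t * (norm u + norm v) < r"
  shows "\<exists>y\<in>ball x r. f (x + t *\<^sub>R u + t *\<^sub>R v) - f (x + t *\<^sub>R u) - f (x + t *\<^sub>R v) + f x
    = t * t * D (\<lambda>z. D f z u) y v"
proof -
  have inball: "x + a *\<^sub>R u + b *\<^sub>R v \<in> ball x r" if "0 \<le> a" "a \<le> t" "0 \<le> b" "b \<le> t" for a b
  proof -
    have "norm (a *\<^sub>R u + b *\<^sub>R v) \<le> norm (a *\<^sub>R u) + norm (b *\<^sub>R v)" by (rule norm_triangle_ineq)
    also have "\<dots> \<le> t * norm u + t * norm v"
      using that by (intro add_mono) (auto intro: mult_right_mono)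
    finally have "norm (a *\<^sub>R u + b *\<^sub>R v) < r" using t by (simp add: algebra_simps)
    then show ?thesis by (simp add: dist_norm norm_minus_commute algebra_simps)
  qed
  define \<phi> where "\<phi> s = f (x + s *\<^sub>R u + t *\<^sub>R v) - f (x + s *\<^sub>R u + 0 *\<^sub>R v)" for s
  have line: "((\<lambda>s. f (x + s *\<^sub>R u + b *\<^sub>R v)) has_derivative (\<lambda>h. h * D f (x + s *\<^sub>R u + b *\<^sub>R v) u)) (at s within {0..t})"
    if "0 \<le> s" "s \<le> t" "0 \<le> b" "b \<le> t" for s b
  proof -
    have "((\<lambda>s. x + s *\<^sub>R u + b *\<^sub>R v) has_derivative (\<lambda>h. h *\<^sub>R u)) (at s within {0..t})"
      by (auto intro!: derivative_eq_intros)
    from has_derivative_compose[OF this has_derivative_D[OF f[OF inball[OF that]]]]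
    show ?thesis using linear_D[OF f[OF inball[OF that]]] by (simp add: linear_cmul)
  qed
  have "(\<phi> has_derivative (\<lambda>h. h * (D f (x + s *\<^sub>R u + t *\<^sub>R v) u - D f (x + s *\<^sub>R u + 0 *\<^sub>R v) u)))
      (at s within {0..t})" if "0 \<le> s" "s \<le> t" for s
    unfolding \<phi>_def right_diff_distrib using t that by (intro has_derivative_diff line) auto
  from mvt_simple[OF t(1) this] obtain s where s: "0 < s" "s < t"
    and es: "\<phi> t - \<phi> 0 = t * (D f (x + s *\<^sub>R u + t *\<^sub>R v) u - D f (x + s *\<^sub>R u + 0 *\<^sub>R v) u)"
    by auto
  define \<psi> where "\<psi> b = D f (x + s *\<^sub>R u + b *\<^sub>R v) u" for b
  have "(\<psi> has_derivative (\<lambda>h. h * D (\<lambda>z. D f z u) (x + s *\<^sub>R u + b *\<^sub>R v) v)) (at b within {0..t})"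
    if "0 \<le> b" "b \<le> t" for b
  proof -
    have *: "x + s *\<^sub>R u + b *\<^sub>R v \<in> ball x r" using s that by (intro inball) auto
    have "((\<lambda>b. x + s *\<^sub>R u + b *\<^sub>R v) has_derivative (\<lambda>h. h *\<^sub>R v)) (at b within {0..t})"
      by (auto intro!: derivative_eq_intros)
    from has_derivative_compose[OF this has_derivative_D[OF Df[OF *]]]
    show ?thesis using linear_D[OF Df[OF *]] by (simp add: linear_cmul \<psi>_def[abs_def])
  qed
  from mvt_simple[OF t(1) this] obtain b where b: "0 < b" "b < t"
    and eb: "\<psi> t - \<psi> 0 = t * D (\<lambda>z. D f z u) (x + s *\<^sub>R u + b *\<^sub>R v) v"
    by auto
  have "\<phi> t - \<phi> 0 = t * t * D (\<lambda>z. D f z u) (x + s *\<^sub>R u + b *\<^sub>R v) v"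
    using es eb by (simp add: \<psi>_def)
  moreover have "x + s *\<^sub>R u + b *\<^sub>R v \<in> ball x r" using s b by (intro inball) auto
  ultimately show ?thesis by (intro bexI[of _ "x + s *\<^sub>R u + b *\<^sub>R v"]) (auto simp: \<phi>_def)
qed

text \<open>The second difference is symmetric in the two directions, so the two mixed derivatives agree at
  points arbitrarily close to \<open>x\<close>; continuity transfers this to \<open>x\<close> itself.\<close>

lemma second_derivative_symmetric_real:
  fixes f :: "'a::real_normed_vector \<Rightarrow> real"
  assumes S: "open S" "x \<in> S" and f: "smooth_on S f"
  shows "D (\<lambda>z. D f z u) x v = D (\<lambda>z. D f z v) x u"
proof (rule ccontr)
  let ?G = "\<lambda>u v y. D (\<lambda>z. D f z u) y v"
  assume neq: "?G u v x \<noteq> ?G v u x"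
  define \<epsilon> where "\<epsilon> = \<bar>?G u v x - ?G v u x\<bar> / 2"
  have \<epsilon>: "\<epsilon> > 0" using neq by (simp add: \<epsilon>_def)
  have cont: "isCont (?G u v) x" for u v
    using smooth_on_imp_continuous[OF smooth_on_D[OF smooth_on_D[OF f]]] S
    by (simp add: continuous_on_eq_continuous_at)
  obtain r1 where r1: "r1 > 0" "\<And>y. dist y x < r1 \<Longrightarrow> dist (?G u v y) (?G u v x) < \<epsilon>"
    using cont[of u v] \<epsilon> unfolding continuous_at_eps_delta by metis
  obtain r2 where r2: "r2 > 0" "\<And>y. dist y x < r2 \<Longrightarrow> dist (?G v u y) (?G v u x) < \<epsilon>"
    using cont[of v u] \<epsilon> unfolding continuous_at_eps_delta by metis
  obtain r3 where r3: "r3 > 0" "ball x r3 \<subseteq> S" using S open_contains_ball by blast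
  define r where "r = min r1 (min r2 r3)"
  have r: "r > 0" "ball x r \<subseteq> S" using r1 r2 r3 by (auto simp: r_def)
  define t where "t = r / (norm u + norm v + 1)"
  have den: "norm u + norm v + 1 > 0" by (smt (verit) norm_ge_zero)
  have t: "t > 0" using r den by (simp add: t_def)
  have tr: "t * (norm u + norm v) < r"
  proof -
    have "t * (norm u + norm v + 1) = r" using den by (simp add: t_def)
    then show ?thesis using t by (simp add: algebra_simps)
  qed
  have d: "f differentiable at y" "(\<lambda>z. D f z u) differentiable at y" if "y \<in> ball x r" for y u
    using that r smooth_on_imp_differentiable[OF f] smooth_on_imp_differentiable[OF smooth_on_D[OF f]]
    by blast+
  obtain y where y: "y \<in> ball x r"
    "f (x + t *\<^sub>R u + t *\<^sub>R v) - f (x + t *\<^sub>R u) - f (x + t *\<^sub>R v) + f x = t * t * ?G u v y"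
    using second_difference_mean_value[OF d t tr] by blast
  have tr': "t * (norm v + norm u) < r" using tr by (simp add: add.commute)
  obtain z where z: "z \<in> ball x r"
    "f (x + t *\<^sub>R v + t *\<^sub>R u) - f (x + t *\<^sub>R v) - f (x + t *\<^sub>R u) + f x = t * t * ?G v u z"
    using second_difference_mean_value[OF d t tr'] by blast
  have "t * t * ?G u v y = t * t * ?G v u z" using y(2) z(2) by (simp add: algebra_simps)
  then have "?G u v y = ?G v u z" using t by simp
  moreover have "\<bar>?G u v y - ?G u v x\<bar> < \<epsilon>" "\<bar>?G v u z - ?G v u x\<bar> < \<epsilon>"
    using r1(2)[of y] r2(2)[of z] y(1) z(1) by (auto simp: r_def dist_commute dist_real_def)
  ultimately show False unfolding \<epsilon>_def by (smt (verit) field_sum_of_halves)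
qed

lemma second_derivative_symmetric:
  fixes f :: "'a::real_normed_vector \<Rightarrow> 'b::euclidean_space"
  assumes S: "open S" "x \<in> S" and f: "smooth_on S f"
  shows "D (\<lambda>z. D f z u) x v = D (\<lambda>z. D f z v) x u"
proof (rule euclidean_eqI)
  fix b :: 'b
  have inner: "D (\<lambda>y. g y \<bullet> b) z w = D g z w \<bullet> b" if "g differentiable at z" for g :: "'a \<Rightarrow> 'b" and z w
    using D_eqI[OF has_derivative_inner_left[OF has_derivative_D[OF that]], of b] by simp
  have "D (\<lambda>z. D f z u) x v \<bullet> b = D (\<lambda>z. D (\<lambda>y. f y \<bullet> b) z u) x v" for u v
  proof -
    have "D (\<lambda>z. D f z u) x v \<bullet> b = D (\<lambda>z. D f z u \<bullet> b) x v"
      using inner smooth_on_imp_differentiable[OF smooth_on_D[OF f] S(2)] by metis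
    also have "D (\<lambda>z. D f z u \<bullet> b) x = D (\<lambda>z. D (\<lambda>y. f y \<bullet> b) z u) x"
      using S inner smooth_on_imp_differentiable[OF f] by (intro D_cong_open) auto
    finally show ?thesis .
  qed
  then show "D (\<lambda>z. D f z u) x v \<bullet> b = D (\<lambda>z. D f z v) x u \<bullet> b"
    using second_derivative_symmetric_real[OF S smooth_on_inner_left[OF S(1) f]] by metis
qed

section \<open>Wedge products and nondegeneracy\<close>

text \<open>A relational form of the fact that a wedge product only sees the first \<open>k + l\<close> vectors and is natural
  in the vector space. It carries the contact condition from the tangent space, where the arguments
  must be tangent vectors, to the coordinate space of a chart.\<close>

lemma wedge_transfer:
  assumes \<alpha>: "\<And>u u'. (\<And>i. i < k \<Longrightarrow> R (u i) (u' i)) \<Longrightarrow> \<alpha> u = \<alpha>' u'"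
    and \<beta>: "\<And>u u'. (\<And>i. i < l \<Longrightarrow> R (u i) (u' i)) \<Longrightarrow> \<beta> u = \<beta>' u'"
    and v: "\<And>i. i < k + l \<Longrightarrow> R (v i) (v' i)"
  shows "wedge k l \<alpha> \<beta> v = wedge k l \<alpha>' \<beta>' v'"
proof -
  have "of_int (sign \<sigma>) * \<alpha> (\<lambda>i. v (\<sigma> i)) * \<beta> (\<lambda>i. v (\<sigma> (k + i)))
      = of_int (sign \<sigma>) * \<alpha>' (\<lambda>i. v' (\<sigma> i)) * \<beta>' (\<lambda>i. v' (\<sigma> (k + i)))"
    if "\<sigma> permutes {..<k + l}" for \<sigma>
  proof -
    have "\<sigma> i < k + l" if "i < k + l" for i
      using permutes_in_image[OF \<open>\<sigma> permutes {..<k + l}\<close>] that by (metis lessThan_iff)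
    then have "\<alpha> (\<lambda>i. v (\<sigma> i)) = \<alpha>' (\<lambda>i. v' (\<sigma> i))"
        "\<beta> (\<lambda>i. v (\<sigma> (k + i))) = \<beta>' (\<lambda>i. v' (\<sigma> (k + i)))"
      by (auto intro!: \<alpha> \<beta> v)
    then show ?thesis by simp
  qed
  then show ?thesis unfolding wedge_def by (auto intro!: arg_cong2[of _ _ _ _ "(/)"] sum.cong)
qed

lemma wedge_power_transfer:
  assumes \<alpha>: "\<And>u u'. (\<And>i. i < k \<Longrightarrow> R (u i) (u' i)) \<Longrightarrow> \<alpha> u = \<alpha>' u'"
  shows "(\<And>i. i < n * k \<Longrightarrow> R (v i) (v' i)) \<Longrightarrow> wedge_power k \<alpha> n v = wedge_power k \<alpha>' n v'"
proof (induction n arbitrary: v v')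
  case (Suc n)
  show ?case unfolding wedge_power.simps
    by (rule wedge_transfer[of k R]) (use Suc \<alpha> in auto)
qed simp

text \<open>The sum over all permutations makes the wedge product alternating, whatever \<open>\<alpha>\<close> and \<open>\<beta>\<close> are: composing
  with a transposition reindexes the sum and flips every sign.\<close>

lemma wedge_transpose:
  assumes "i < k + l" "j < k + l" "i \<noteq> j"
  shows "wedge k l \<alpha> \<beta> (\<lambda>a. v (Transposition.transpose i j a)) = - wedge k l \<alpha> \<beta> v"
proof -
  let ?\<tau> = "Transposition.transpose i j"
  let ?P = "{\<sigma>. \<sigma> permutes {..<k + l}}"
  let ?f = "\<lambda>\<sigma>. of_int (sign \<sigma>) * \<alpha> (\<lambda>i. v (\<sigma> i)) * \<beta> (\<lambda>i. v (\<sigma> (k + i))) :: real"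
  have \<tau>: "?\<tau> permutes {..<k + l}" using assms by (intro permutes_swap_id) auto
  have "(\<Sum>\<sigma>\<in>?P. of_int (sign \<sigma>) * \<alpha> (\<lambda>i. v (?\<tau> (\<sigma> i))) * \<beta> (\<lambda>i. v (?\<tau> (\<sigma> (k + i)))))
      = (\<Sum>\<sigma>\<in>?P. - ?f (?\<tau> \<circ> \<sigma>))"
  proof (intro sum.cong refl)
    fix \<sigma> assume "\<sigma> \<in> ?P"
    then have "permutation \<sigma>" "permutation ?\<tau>" using \<tau> by (auto intro: permutation_permutes[THEN iffD2])
    then have "sign (?\<tau> \<circ> \<sigma>) = - sign \<sigma>" using assms(3) by (simp add: sign_compose sign_swap_id)
    then show "of_int (sign \<sigma>) * \<alpha> (\<lambda>i. v (?\<tau> (\<sigma> i))) * \<beta> (\<lambda>i. v (?\<tau> (\<sigma> (k + i)))) = - ?f (?\<tau> \<circ> \<sigma>)"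
      by simp
  qed
  also have "\<dots> = - (\<Sum>\<sigma>\<in>?P. ?f \<sigma>)"
    using setum_permutations_compose_left[OF \<tau>, of ?f] by (simp add: sum_negf)
  finally show ?thesis unfolding wedge_def by simp
qed

lemma wedge_repeated_eq_0:
  assumes "i < k + l" "j < k + l" "i \<noteq> j" "v i = v j"
  shows "wedge k l \<alpha> \<beta> v = 0"
proof -
  have "(\<lambda>a. v (Transposition.transpose i j a)) = v" using assms(4) by (auto simp: Transposition.transpose_def)
  then show ?thesis using wedge_transpose[OF assms(1-3), of \<alpha> \<beta> v] by simp
qed

lemma permutes_preimage:
  fixes m :: nat
  assumes "\<sigma> permutes {..<m}" "j < m"
  obtains i where "i < m" "\<sigma> i = j"
proof -
  have "j \<in> \<sigma> ` {..<m}" using assms by (simp add: permutes_image)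
  then show thesis using that by auto
qed

lemma linear_mult_both:
  fixes f :: "'v::real_vector \<Rightarrow> real"
  assumes "linear f" shows "linear (\<lambda>x. c * f x * d)"
  using linear_add[OF assms] linear_cmul[OF assms] by (intro linearI) (simp_all add: algebra_simps)

text \<open>In every summand the vector \<open>w\<close> is an argument either of \<open>\<alpha>\<close> or of \<open>\<beta>\<close>.\<close>

lemma wedge_kernel_eq_0:
  assumes \<alpha>: "\<And>u i. i < k \<Longrightarrow> u i = w \<Longrightarrow> \<alpha> u = 0" and \<beta>: "\<And>u i. i < l \<Longrightarrow> u i = w \<Longrightarrow> \<beta> u = 0"
    and j: "j < k + l" "v j = w"
  shows "wedge k l \<alpha> \<beta> v = 0"
proof -
  have "of_int (sign \<sigma>) * \<alpha> (\<lambda>i. v (\<sigma> i)) * \<beta> (\<lambda>i. v (\<sigma> (k + i))) = 0"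
    if \<sigma>: "\<sigma> permutes {..<k + l}" for \<sigma>
  proof -
    obtain i where i: "i < k + l" "\<sigma> i = j"
      using permutes_preimage[OF \<sigma> j(1)] .
    show ?thesis
    proof (cases "i < k")
      case True
      then show ?thesis using \<alpha>[of i "\<lambda>i. v (\<sigma> i)"] i j by simp
    next
      case False
      then show ?thesis using \<beta>[of "i - k" "\<lambda>i. v (\<sigma> (k + i))"] i j by simp
    qed
  qed
  then show ?thesis unfolding wedge_def by (subst sum.neutral) auto
qed

lemma wedge_power_kernel_eq_0:
  assumes \<alpha>: "\<And>u i. i < k \<Longrightarrow> u i = w \<Longrightarrow> \<alpha> u = 0"
  shows "j < n * k \<Longrightarrow> v j = w \<Longrightarrow> wedge_power k \<alpha> n v = 0"
proof (induction n arbitrary: v j)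
  case (Suc n)
  show ?case unfolding wedge_power.simps
    by (rule wedge_kernel_eq_0[of k w]) (use Suc \<alpha> in auto)
qed simp

text \<open>A form is a function of a whole sequence of vectors, so multilinearity includes that only the first
  \<open>k\<close> of them matter.\<close>

definition multilinear_form :: "nat \<Rightarrow> ((nat \<Rightarrow> 'v::real_vector) \<Rightarrow> real) \<Rightarrow> bool" where
  "multilinear_form k \<alpha> \<longleftrightarrow> (\<forall>i<k. \<forall>u. linear (\<lambda>x. \<alpha> (u(i := x)))) \<and>
     (\<forall>u u'. (\<forall>i<k. u i = u' i) \<longrightarrow> \<alpha> u = \<alpha> u')"

lemma multilinear_form_linear: "multilinear_form k \<alpha> \<Longrightarrow> i < k \<Longrightarrow> linear (\<lambda>x. \<alpha> (u(i := x)))"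
  by (simp add: multilinear_form_def)

lemma multilinear_form_cong: "multilinear_form k \<alpha> \<Longrightarrow> (\<And>i. i < k \<Longrightarrow> u i = u' i) \<Longrightarrow> \<alpha> u = \<alpha> u'"
  by (simp add: multilinear_form_def)

lemma multilinear_form_wedge:
  assumes \<alpha>: "multilinear_form k \<alpha>" and \<beta>: "multilinear_form l \<beta>"
  shows "multilinear_form (k + l) (wedge k l \<alpha> \<beta>)"
  unfolding multilinear_form_def
proof (intro conjI allI impI)
  fix j u assume j: "j < k + l"
  define T where "T \<sigma> x = of_int (sign \<sigma>) * \<alpha> (\<lambda>i. (u(j := x)) (\<sigma> i)) * \<beta> (\<lambda>i. (u(j := x)) (\<sigma> (k + i)))" for \<sigma> x
  have lin: "linear (T \<sigma>)" if \<sigma>: "\<sigma> permutes {..<k + l}" for \<sigma>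
  proof -
    obtain i where i: "i < k + l" "\<sigma> i = j"
      using permutes_preimage[OF \<sigma> j] .
    have eq: "\<sigma> a = j \<longleftrightarrow> a = i" for a using i(2) permutes_inj[OF \<sigma>] by (metis injD)
    show ?thesis
    proof (cases "i < k")
      case True
      have "(\<lambda>a. (u(j := x)) (\<sigma> (k + a))) = (\<lambda>a. u (\<sigma> (k + a)))" for x
        using True by (auto simp: eq)
      moreover have "(\<lambda>a. (u(j := x)) (\<sigma> a)) = (\<lambda>a. u (\<sigma> a))(i := x)" for x
        by (auto simp: eq fun_eq_iff)
      ultimately have "T \<sigma> = (\<lambda>x. of_int (sign \<sigma>) * \<alpha> ((\<lambda>a. u (\<sigma> a))(i := x)) * \<beta> (\<lambda>a. u (\<sigma> (k + a))))"
        unfolding T_def by (simp only:)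
      then show ?thesis
        using linear_mult_both[OF multilinear_form_linear[OF \<alpha> True]] by (simp only:)
    next
      case False
      have "\<alpha> (\<lambda>a. (u(j := x)) (\<sigma> a)) = \<alpha> (\<lambda>a. u (\<sigma> a))" for x
        by (rule multilinear_form_cong[OF \<alpha>]) (use False in \<open>auto simp: eq\<close>)
      moreover have "(\<lambda>a. (u(j := x)) (\<sigma> (k + a))) = (\<lambda>a. u (\<sigma> (k + a)))(i - k := x)" for x
        using False by (auto simp: eq fun_eq_iff)
      ultimately have "T \<sigma> = (\<lambda>x. (of_int (sign \<sigma>) * \<alpha> (\<lambda>a. u (\<sigma> a))) * \<beta> ((\<lambda>a. u (\<sigma> (k + a)))(i - k := x)) * 1)"
        unfolding T_def by (simp only: mult_1_right)
      then show ?thesis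
        using linear_mult_both[OF multilinear_form_linear[OF \<beta>, of "i - k"], of _ _ 1] i False by simp
    qed
  qed
  have "linear (\<lambda>x. \<Sum>\<sigma> | \<sigma> permutes {..<k + l}. T \<sigma> x)"
    by (rule linear_compose_sum) (simp add: lin)
  from linear_mult_both[OF this, of 1 "inverse (fact k * fact l)"]
  have "linear (\<lambda>x. (\<Sum>\<sigma> | \<sigma> permutes {..<k + l}. T \<sigma> x) / (fact k * fact l))"
    by (simp only: mult_1_left divide_inverse)
  then show "linear (\<lambda>x. wedge k l \<alpha> \<beta> (u(j := x)))" unfolding wedge_def T_def .
next
  fix u u' :: "nat \<Rightarrow> 'a" assume "\<forall>i<k + l. u i = u' i"
  then show "wedge k l \<alpha> \<beta> u = wedge k l \<alpha> \<beta> u'"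
    using \<alpha> \<beta> by (intro wedge_transfer[where R = "(=)"]) (auto simp: multilinear_form_def)
qed

lemma multilinear_form_wedge_power:
  "multilinear_form k \<alpha> \<Longrightarrow> multilinear_form (n * k) (wedge_power k \<alpha> n)"
proof (induction n)
  case 0
  then show ?case by (simp add: multilinear_form_def)
next
  case (Suc n)
  then show ?case using multilinear_form_wedge by simp
qed

text \<open>A nonzero alternating form of top degree has no kernel. For a basis \<open>b\<^sub>j\<close>, the linear map
  \<open>\<Psi>(x) = \<Sum>\<^sub>j \<Omega>(v\<^sub>0, \<dots>, x, \<dots>) b\<^sub>j\<close>, with \<open>x\<close> in place \<open>j\<close>, sends \<open>v\<^sub>i\<close> to \<open>\<Omega>(v) b\<^sub>i\<close>; hence it is onto,
  hence injective, and it kills \<open>w\<close>.\<close>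

lemma alternating_top_form_kernel:
  fixes v :: "nat \<Rightarrow> 'e::euclidean_space"
  assumes ml: "multilinear_form (DIM('e)) \<Omega>"
    and alt: "\<And>u i j. i < DIM('e) \<Longrightarrow> j < DIM('e) \<Longrightarrow> i \<noteq> j \<Longrightarrow> u i = u j \<Longrightarrow> \<Omega> u = 0"
    and v: "\<Omega> v \<noteq> 0" and w: "\<And>j. j < DIM('e) \<Longrightarrow> \<Omega> (v(j := w)) = 0"
  shows "w = 0"
proof -
  let ?m = "DIM('e)"
  obtain b where b: "bij_betw b {..<?m} (Basis :: 'e set)"
    using ex_bij_betw_nat_finite[OF finite_Basis] by (metis atLeast0LessThan)
  define \<Psi> where "\<Psi> x = (\<Sum>j<?m. \<Omega> (v(j := x)) *\<^sub>R b j)" for x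
  have lin: "linear \<Psi>" unfolding \<Psi>_def
  proof (rule linear_compose_sum, rule ballI)
    fix j assume "j \<in> {..<?m}"
    then have "linear (\<lambda>x. \<Omega> (v(j := x)))" using multilinear_form_linear[OF ml] by simp
    then show "linear (\<lambda>x. \<Omega> (v(j := x)) *\<^sub>R b j)"
      using linear_compose[of "\<lambda>x. \<Omega> (v(j := x))" "\<lambda>r. r *\<^sub>R b j"]
      by (simp add: o_def linear_iff scaleR_add_left)
  qed
  have \<Psi>v: "\<Psi> (v i) = \<Omega> v *\<^sub>R b i" if "i < ?m" for i
  proof -
    have "\<Omega> (v(j := v i)) *\<^sub>R b j = (if j = i then \<Omega> v *\<^sub>R b i else 0)" if "j < ?m" for j
      using alt[of i j "v(j := v i)"] that \<open>i < ?m\<close> by auto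
    then show ?thesis using that unfolding \<Psi>_def by (simp add: sum.delta)
  qed
  have "surj \<Psi>"
  proof (rule surjI)
    fix y
    have "\<Psi> (\<Sum>i<?m. ((y \<bullet> b i) / \<Omega> v) *\<^sub>R v i) = (\<Sum>i<?m. (y \<bullet> b i) *\<^sub>R b i)"
      using v lin by (simp add: linear_sum linear_cmul \<Psi>v)
    also have "\<dots> = (\<Sum>e\<in>Basis. (y \<bullet> e) *\<^sub>R e)"
      by (rule sum.reindex_bij_betw[OF b])
    finally show "\<Psi> (\<Sum>i<?m. ((y \<bullet> b i) / \<Omega> v) *\<^sub>R v i) = y" by (simp add: euclidean_representation)
  qed
  with lin have "inj \<Psi>" by (rule linear_surjective_imp_injective) (rule refl)
  moreover have "\<Psi> w = \<Psi> 0" using w by (simp add: linear_0[OF lin], simp add: \<Psi>_def)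
  ultimately show ?thesis by (simp add: inj_eq)
qed

text \<open>A vector that is annihilated by \<open>a\<close> and by \<open>b\<close> is in the kernel of the top-degree form
  \<open>a \<and> b\<^sup>n\<close>.\<close>

lemma contact_condition_nondegenerate:
  fixes a :: "'e::euclidean_space \<Rightarrow> real" and b :: "'e \<Rightarrow> 'e \<Rightarrow> real"
  assumes a: "linear a" and b: "bilinear b" and antisym: "\<And>x y. b x y = - b y x"
    and dim: "DIM('e) = 2 * n + 1"
    and v: "wedge 1 (2 * n) (\<lambda>u. a (u 0)) (wedge_power 2 (\<lambda>u. b (u 0) (u 1)) n) v \<noteq> 0"
    and w: "a w = 0" "\<And>x. b w x = 0"
  shows "w = 0"
proof -
  let ?\<beta> = "\<lambda>u. b (u 0) (u 1)"
  let ?\<Omega> = "wedge 1 (2 * n) (\<lambda>u. a (u 0)) (wedge_power 2 ?\<beta> n)"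
  have dim': "DIM('e) = 1 + 2 * n" using dim by simp
  have "multilinear_form 2 ?\<beta>"
    using b by (auto simp: multilinear_form_def bilinear_def less_2_cases_iff)
  from multilinear_form_wedge_power[OF this, of n]
  have 2: "multilinear_form (2 * n) (wedge_power 2 ?\<beta> n)" by (simp add: mult.commute)
  have 1: "multilinear_form 1 (\<lambda>u. a (u 0))" using a by (auto simp: multilinear_form_def)
  have ker: "?\<beta> u = 0" if "i < 2" "u i = w" for u and i :: nat
    using that w(2)[of "u 1"] w(2)[of "u 0"] antisym[of "u 0" w] by (auto simp: less_2_cases_iff)
  show ?thesis
  proof (rule alternating_top_form_kernel[of ?\<Omega> v])
    show "multilinear_form DIM('e) ?\<Omega>" unfolding dim' by (rule multilinear_form_wedge[OF 1 2])
    show "?\<Omega> u = 0" if "i < DIM('e)" "j < DIM('e)" "i \<noteq> j" "u i = u j" for u i j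
      using that unfolding dim' by (rule wedge_repeated_eq_0)
    show "?\<Omega> (v(j := w)) = 0" if "j < DIM('e)" for j
      by (rule wedge_kernel_eq_0[of 1 w _ "2 * n" _ j])
        (use that w(1) wedge_power_kernel_eq_0[of 2 w ?\<beta> _ n] ker in \<open>auto simp: dim' mult.commute\<close>)
  qed (rule v)
qed

section \<open>Bilinear forms and linear equations\<close>

text \<open>The matrix is transposed so that multiplication by it represents the first argument of \<open>b\<close>, which is
  the unknown in all the equations below.\<close>

definition gram :: "(real ^ 'm \<Rightarrow> real ^ 'm \<Rightarrow> real) \<Rightarrow> real ^ 'm ^ 'm" where
  "gram b = (\<chi> i j. b (axis j 1) (axis i 1))"

lemma linear_axis_expansion:
  fixes r :: "real ^ 'm \<Rightarrow> real"
  assumes "linear r"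
  shows "r x = (\<Sum>i\<in>UNIV. x $ i * r (axis i 1))"
proof -
  have "r x = r (\<Sum>i\<in>UNIV. x $ i *s axis i 1)" by (simp add: basis_expansion)
  then show ?thesis using assms by (simp add: linear_sum linear_cmul scalar_mult_eq_scaleR)
qed

lemma gram_mult_eq_iff:
  assumes b: "bilinear b" and r: "linear r"
  shows "gram b *v x = (\<chi> i. r (axis i 1)) \<longleftrightarrow> (\<forall>v. b x v = r v)"
proof -
  have lin: "linear (b y)" "linear (\<lambda>y. b y z)" for y z using b by (auto simp: bilinear_def)
  have comp: "(gram b *v x) $ i = b x (axis i 1)" for i
    using linear_axis_expansion[OF lin(2), of x "axis i 1"]
    by (simp add: gram_def matrix_vector_mult_def mult.commute)
  have "gram b *v x = (\<chi> i. r (axis i 1)) \<longleftrightarrow> (\<forall>i. b x (axis i 1) = r (axis i 1))"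
    by (simp add: vec_eq_iff comp)
  also have "\<dots> \<longleftrightarrow> (\<forall>v. b x v = r v)"
  proof (intro iffI allI)
    fix v assume *: "\<forall>i. b x (axis i 1) = r (axis i 1)"
    show "b x v = r v"
      by (subst linear_axis_expansion[OF lin(1)], subst linear_axis_expansion[OF r]) (simp add: *)
  qed simp
  finally show ?thesis .
qed

lemma det_gram_eq_0_iff:
  assumes "bilinear b"
  shows "det (gram b) = 0 \<longleftrightarrow> (\<exists>x. x \<noteq> 0 \<and> (\<forall>v. b x v = 0))"
proof -
  have "linear (\<lambda>v :: real ^ 'a. 0 :: real)" by (simp add: linear_iff)
  from gram_mult_eq_iff[OF assms this] have "gram b *v x = 0 \<longleftrightarrow> (\<forall>v. b x v = 0)" for x
    by (simp add: vec_eq_iff zero_vec_def)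
  then show ?thesis using invertible_det_nz[of "gram b"] matrix_left_invertible_ker[of "gram b"] by (auto simp: invertible_left_inverse)
qed

lemma nondegenerate_solvable:
  fixes b :: "real ^ 'm \<Rightarrow> real ^ 'm \<Rightarrow> real"
  assumes b: "bilinear b" and nd: "\<And>x. (\<And>v. b x v = 0) \<Longrightarrow> x = 0" and r: "linear r"
  shows "\<exists>x. \<forall>v. b x v = r v"
proof -
  have "det (gram b) \<noteq> 0" using det_gram_eq_0_iff[OF b] nd by blast
  from cramer[OF this] show ?thesis using gram_mult_eq_iff[OF b r] by blast
qed

lemma smooth_on_det:
  fixes M :: "'a::real_normed_vector \<Rightarrow> real ^ 'm ^ 'm"
  assumes "open S" "\<And>i j. smooth_on S (\<lambda>x. M x $ i $ j)"
  shows "smooth_on S (\<lambda>x. det (M x))"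
  unfolding det_def
  by (intro smooth_on_sum smooth_on_mult smooth_on_prod smooth_on_const assms)

text \<open>Cramer's rule writes the solution as a quotient of determinants, and determinants are polynomials in
  the coefficients.\<close>

lemma smooth_on_solution:
  fixes b :: "'a::real_normed_vector \<Rightarrow> real ^ 'm \<Rightarrow> real ^ 'm \<Rightarrow> real"
  assumes S: "open S" and b: "\<And>x. x \<in> S \<Longrightarrow> bilinear (b x)"
    and nd: "\<And>x w. x \<in> S \<Longrightarrow> (\<And>v. b x w v = 0) \<Longrightarrow> w = 0"
    and r: "\<And>x. x \<in> S \<Longrightarrow> linear (r x)"
    and sb: "\<And>v w. smooth_on S (\<lambda>x. b x v w)" and sr: "\<And>v. smooth_on S (\<lambda>x. r x v)"
    and X: "\<And>x v. x \<in> S \<Longrightarrow> b x (X x) v = r x v"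
  shows "smooth_on S X"
proof -
  let ?r = "\<lambda>x. \<chi> i. r x (axis i 1)"
  let ?N = "\<lambda>k x. \<chi> i j. if j = k then ?r x $ i else gram (b x) $ i $ j"
  have det: "det (gram (b x)) \<noteq> 0" if "x \<in> S" for x
    using det_gram_eq_0_iff[OF b[OF that]] nd[OF that] by blast
  have sol: "X x = (\<chi> k. det (?N k x) / det (gram (b x)))" if "x \<in> S" for x
    using gram_mult_eq_iff[OF b[OF that] r[OF that], of "X x"] X[OF that] cramer[OF det[OF that]] by blast
  have comp: "smooth_on S (\<lambda>x. det (?N k x) / det (gram (b x)))" for k
  proof (intro smooth_on_divide smooth_on_det S det)
    show "smooth_on S (\<lambda>x. ?N k x $ i $ j)" for i j
      by (cases "j = k") (simp_all add: gram_def sb sr)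
    show "smooth_on S (\<lambda>x. gram (b x) $ i $ j)" for i j by (simp add: gram_def sb)
  qed
  show ?thesis
  proof (rule smooth_on_componentwise[OF S])
    fix e :: "real ^ 'm" assume "e \<in> Basis"
    then obtain k where e: "e = axis k 1" by (auto simp: Basis_vec_def)
    have "X x \<bullet> e = det (?N k x) / det (gram (b x))" if "x \<in> S" for x
      by (subst sol[OF that]) (simp add: e inner_axis)
    then show "smooth_on S (\<lambda>x. X x \<bullet> e)"
      by (subst smooth_on_cong[OF S, of _ "\<lambda>x. det (?N k x) / det (gram (b x))"]) (simp_all add: comp)
  qed
qed

text \<open>The matrix \<open>M\<close> of \<open>b\<close> satisfies \<open>det M = det M\<^sup>T = det (- M) = - det M\<close> in odd dimension.\<close>

lemma odd_alternating_kernel: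
  fixes b :: "real ^ 'm \<Rightarrow> real ^ 'm \<Rightarrow> real"
  assumes b: "bilinear b" and antisym: "\<And>x y. b x y = - b y x" and odd: "odd CARD('m)"
  shows "\<exists>x. x \<noteq> 0 \<and> (\<forall>v. b x v = 0)"
proof -
  have "transpose (gram b) = (\<chi> i. (- 1) *s gram b $ i)"
    by (simp add: vec_eq_iff transpose_def gram_def) (metis antisym)
  then have "det (gram b) = (\<Prod>i\<in>(UNIV :: 'm set). - 1) * det (gram b)"
    using det_rows_mul[of "\<lambda>i. - 1" "\<lambda>i. gram b $ i"] det_transpose[of "gram b"] by simp
  then have "det (gram b) = - det (gram b)" using odd by simp
  then have "det (gram b) = 0" by linarith
  then show ?thesis using det_gram_eq_0_iff[OF b] by blast
qed

text \<open>The linear algebra of one tangent space: \<open>a\<close> and \<open>b\<close> stand for the values of \<open>\<theta>\<close> and \<open>d\<theta>\<close> at a point.\<close>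

locale linear_contact =
  fixes a :: "real ^ 'm \<Rightarrow> real" and b :: "real ^ 'm \<Rightarrow> real ^ 'm \<Rightarrow> real"
  assumes a: "linear a" and b: "bilinear b" and antisym: "b x y = - b y x"
    and nondegenerate: "a w = 0 \<Longrightarrow> (\<And>x. b w x = 0) \<Longrightarrow> w = 0"
begin

text \<open>Adding \<open>\<theta> \<otimes> \<theta>\<close> to \<open>d\<theta>\<close> turns the two conditions on \<open>\<theta>(w)\<close> and \<open>d\<theta>(w, \<cdot>)\<close>, by which the Reeb field and
  \<open>\<Lambda>\<^sup>#\<close> are defined, into a single system of linear equations with a square, invertible matrix.\<close>

definition pairing :: "real ^ 'm \<Rightarrow> real ^ 'm \<Rightarrow> real" where
  "pairing w v = b w v + a w * a v"

lemma alternating: "b x x = 0"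
  using antisym[of x x] by simp

lemma bilinear_pairing: "bilinear pairing"
proof -
  show ?thesis unfolding pairing_def bilinear_def using linear_add[OF a] linear_cmul[OF a]
    by (auto intro!: linearI simp: algebra_simps
        bilinear_ladd[OF b] bilinear_lmul[OF b] bilinear_radd[OF b] bilinear_rmul[OF b])
qed

text \<open>The term \<open>d\<theta>\<close> is alternating, so pairing \<open>w\<close> with itself gives \<open>\<theta>(w)\<^sup>2\<close>.\<close>

lemma pairing_nondegenerate: 
  assumes "\<And>v. pairing w v = 0" shows "w = 0"
proof -
  have "a w = 0" using assms[of w] by (simp add: pairing_def alternating)
  then show ?thesis using assms nondegenerate by (simp add: pairing_def)
qed

text \<open>A vector in the kernel of \<open>b\<close>, which exists because the dimension is odd, can be normalised by \<open>a\<close>.\<close>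

lemma reeb_exists:
  assumes "odd CARD('m)"
  shows "\<exists>\<xi>. a \<xi> = 1 \<and> (\<forall>v. b \<xi> v = 0)"
proof -
  obtain x where x: "x \<noteq> 0" "\<And>v. b x v = 0" using odd_alternating_kernel[OF b antisym assms] by blast
  then have "a x \<noteq> 0" using nondegenerate by blast
  moreover have "b (inverse (a x) *\<^sub>R x) v = 0" for v using x by (simp add: bilinear_lmul[OF b])
  ultimately show ?thesis using a by (intro exI[of _ "inverse (a x) *\<^sub>R x"]) (simp add: linear_cmul)
qed

text \<open>Solving for the pairing in place of \<open>b\<close> is enough: evaluating the solved equation at \<open>\<xi>\<close> gives
  \<open>a w = 0\<close>, so the pairing with \<open>w\<close> is \<open>b w\<close>.\<close>

lemma sharp_exists:
  assumes \<xi>: "a \<xi> = 1" "\<And>v. b \<xi> v = 0" and \<eta>: "linear \<eta>"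
  shows "\<exists>w. a w = 0 \<and> (\<forall>v. b w v = \<eta> \<xi> * a v - \<eta> v)"
proof -
  have "linear (\<lambda>v. \<eta> \<xi> * a v - \<eta> v)" using a \<eta>
    by (intro linearI) (simp_all add: linear_add linear_cmul algebra_simps)
  then obtain w where w: "\<And>v. pairing w v = \<eta> \<xi> * a v - \<eta> v"
    using nondegenerate_solvable[OF bilinear_pairing pairing_nondegenerate] by blast
  have "a w = 0" using w[of \<xi>] \<xi> antisym[of w \<xi>] by (simp add: pairing_def)
  then show ?thesis using w by (auto simp: pairing_def)
qed

end

section \<open>The Jacobi identity in a coordinate chart\<close>

text \<open>The exterior derivative of the one-form with value \<open>t x\<close> at \<open>x\<close>, evaluated on constant vectors.\<close>

definition dform :: "('e::real_normed_vector \<Rightarrow> 'e \<Rightarrow> real) \<Rightarrow> 'e \<Rightarrow> 'e \<Rightarrow> 'e \<Rightarrow> real" where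
  "dform t x v w = D (\<lambda>y. t y w) x v - D (\<lambda>y. t y v) x w"

lemma dform_antisym: "dform t x v w = - dform t x w v"
  by (simp add: dform_def)

locale open_form =
  fixes U :: "'e::euclidean_space set" and t :: "'e \<Rightarrow> 'e \<Rightarrow> real"
  assumes U: "open U"
    and linear_t: "x \<in> U \<Longrightarrow> linear (t x)" and smooth_t: "smooth_on U (\<lambda>x. t x e)"
begin

lemma diff_t: "x \<in> U \<Longrightarrow> (\<lambda>y. t y e) differentiable at x"
  using smooth_on_imp_differentiable[OF smooth_t] .

lemma smooth_dform: "smooth_on U (\<lambda>x. dform t x v w)"
  unfolding dform_def by (intro smooth_on_diff smooth_on_D smooth_t U)

lemma D_t_add_scale:
  assumes x: "x \<in> U"
  shows "D (\<lambda>y. t y (r *\<^sub>R v + s *\<^sub>R w)) x u = r * D (\<lambda>y. t y v) x u + s * D (\<lambda>y. t y w) x u"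
proof -
  have "((\<lambda>y. r * t y v + s * t y w) has_derivative
      (\<lambda>u. r * D (\<lambda>y. t y v) x u + s * D (\<lambda>y. t y w) x u)) (at x)"
    by (intro has_derivative_add has_derivative_mult_right has_derivative_D diff_t x)
  then have "((\<lambda>y. t y (r *\<^sub>R v + s *\<^sub>R w)) has_derivative
      (\<lambda>u. r * D (\<lambda>y. t y v) x u + s * D (\<lambda>y. t y w) x u)) (at x)"
    by (subst has_derivative_cong_open[OF U x]) (auto simp: linear_add[OF linear_t] linear_cmul[OF linear_t])
  then show ?thesis by (simp add: D_eqI)
qed

lemma linear_D_t: "x \<in> U \<Longrightarrow> linear (\<lambda>v. D (\<lambda>y. t y v) x u)"
  using D_t_add_scale[of x 1 _ 1] D_t_add_scale[of x _ _ 0] by (intro linearI) simp_all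

lemma bilinear_dform: "x \<in> U \<Longrightarrow> bilinear (dform t x)"
  using linear_D_t linear_D[OF diff_t] unfolding dform_def bilinear_def
  by (auto intro!: linear_compose_sub)

lemma D_t_field:
  assumes x: "x \<in> U" and Y: "Y differentiable at x"
  shows "D (\<lambda>y. t y (Y y)) x v = D (\<lambda>y. t y (Y x)) x v + t x (D Y x v)"
  by (subst D_eqI[OF has_derivative_apply_field[OF U x linear_t diff_t[OF x] Y]]) auto

lemma D_dform_fields:
  assumes x: "x \<in> U" and Y: "smooth_on U Y" and Z: "smooth_on U Z"
  shows "D (\<lambda>y. dform t y (Y y) (Z y)) x v =
    D (\<lambda>y. dform t y (Y x) (Z x)) x v + dform t x (D Y x v) (Z x) + dform t x (Y x) (D Z x v)"
proof -
  have lin1: "linear (\<lambda>e. dform t y e w)" and lin2: "linear (dform t y w)" if "y \<in> U" for y w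
    using bilinear_dform[OF that] by (auto simp: bilinear_def)
  have dY: "Y differentiable at x" and dZ: "Z differentiable at x"
    using Y Z x smooth_on_imp_differentiable by auto
  have "smooth_on U (\<lambda>y. dform t y (Y y) e)" for e
    by (rule smooth_on_apply_field[OF U lin1 smooth_dform Y])
  note dd = smooth_on_imp_differentiable[OF this x]
  have "D (\<lambda>y. dform t y (Y y) (Z y)) x v = D (\<lambda>y. dform t y (Y y) (Z x)) x v + dform t x (Y x) (D Z x v)"
    by (subst D_eqI[OF has_derivative_apply_field[OF U x lin2 dd dZ]]) auto
  also have "D (\<lambda>y. dform t y (Y y) (Z x)) x v = D (\<lambda>y. dform t y (Y x) (Z x)) x v + dform t x (D Y x v) (Z x)"
    by (subst D_eqI[OF has_derivative_apply_field[OF U x lin1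
        smooth_on_imp_differentiable[OF smooth_dform x] dY]]) auto
  finally show ?thesis by simp
qed

text \<open>This is \<open>d(d\<theta>) = 0\<close>; the six second derivatives cancel in pairs by symmetry.\<close>

lemma dform_closed:
  assumes x: "x \<in> U"
  shows "D (\<lambda>y. dform t y v w) x u + D (\<lambda>y. dform t y w u) x v + D (\<lambda>y. dform t y u v) x w = 0"
proof -
  have 1: "D (\<lambda>y. dform t y v w) x u = D (\<lambda>y. D (\<lambda>y. t y w) y v) x u - D (\<lambda>y. D (\<lambda>y. t y v) y w) x u" for u v w
  proof -
    have "(\<lambda>y. D (\<lambda>y. t y w) y v) differentiable at x" for v w
      by (rule smooth_on_imp_differentiable[OF smooth_on_D[OF smooth_t] x])
    from D_eqI[OF has_derivative_diff[OF has_derivative_D[OF this] has_derivative_D[OF this]]]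
    show ?thesis unfolding dform_def by simp
  qed
  show ?thesis unfolding 1 using second_derivative_symmetric[OF U x smooth_t] by (simp add: algebra_simps)
qed

text \<open>Cartan's formulas for \<open>d\<theta>\<close> and \<open>d(d\<theta>)\<close>, with the Lie bracket \<open>DY[X] - DX[Y]\<close> of vector fields.\<close>

lemma dform_fields:
  assumes x: "x \<in> U" and X: "smooth_on U X" and Y: "smooth_on U Y"
  shows "dform t x (X x) (Y x) = D (\<lambda>y. t y (Y y)) x (X x) - D (\<lambda>y. t y (X y)) x (Y x)
    - t x (D Y x (X x) - D X x (Y x))"
  using D_t_field[OF x smooth_on_imp_differentiable[OF X x]] D_t_field[OF x smooth_on_imp_differentiable[OF Y x]]
  by (simp add: dform_def linear_diff[OF linear_t[OF x]])

lemma dform_closed_fields: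
  assumes x: "x \<in> U" and X: "smooth_on U X" and Y: "smooth_on U Y" and Z: "smooth_on U Z"
  shows "D (\<lambda>y. dform t y (Y y) (Z y)) x (X x) + D (\<lambda>y. dform t y (Z y) (X y)) x (Y x)
    + D (\<lambda>y. dform t y (X y) (Y y)) x (Z x)
    = dform t x (D Y x (X x) - D X x (Y x)) (Z x) + dform t x (D Z x (Y x) - D Y x (Z x)) (X x)
    + dform t x (D X x (Z x) - D Z x (X x)) (Y x)"
  using dform_closed[OF x, of "Y x" "Z x" "X x"] dform_antisym[of t x "X x" "D _ x _"]
    dform_antisym[of t x "Y x" "D _ x _"] dform_antisym[of t x "Z x" "D _ x _"]
  by (simp add: D_dform_fields[OF x] X Y Z bilinear_lsub[OF bilinear_dform[OF x]])

end

text \<open>The commutator of the derivations \<open>X\<close> and \<open>Y\<close> is the derivation along their Lie bracket: the terms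
  with second derivatives of \<open>h\<close> cancel by symmetry.\<close>

lemma D_D_field_commutator:
  fixes h :: "'e::euclidean_space \<Rightarrow> real"
  assumes U: "open U" "x \<in> U" and h: "smooth_on U h" and X: "smooth_on U X" and Y: "smooth_on U Y"
  shows "D (\<lambda>y. D h y (Y y)) x (X x) - D (\<lambda>y. D h y (X y)) x (Y x) = D h x (D Y x (X x) - D X x (Y x))"
proof -
  have lin: "linear (D h y)" if "y \<in> U" for y
    using smooth_on_imp_differentiable[OF h that] by (rule linear_D)
  have *: "D (\<lambda>y. D h y (Y y)) x v = D (\<lambda>y. D h y (Y x)) x v + D h x (D Y x v)"
    if "smooth_on U Y" for Y v
    by (subst D_eqI[OF has_derivative_apply_field[OF U lin smooth_on_imp_differentiable[OF smooth_on_D[OF h] U(2)]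
        smooth_on_imp_differentiable[OF that U(2)]]]) auto
  show ?thesis
    using second_derivative_symmetric[OF U h, of "Y x" "X x"]
    by (simp add: *[OF X] *[OF Y] linear_diff[OF lin[OF U(2)]])
qed

text \<open>\<open>F\<close>, \<open>R\<close> and \<open>X\<close> are a Hamiltonian function, its derivative along the Reeb field, and its Hamiltonian
  vector field; the equations are those that the latter inherits from the map \<open>\<Lambda>\<^sup>#\<close>.\<close>

locale hamiltonian_data = open_form U t for U :: "'e::euclidean_space set" and t +
  fixes F R :: "'i \<Rightarrow> 'e \<Rightarrow> real" and X :: "'i \<Rightarrow> 'e \<Rightarrow> 'e"
  assumes smooth_F: "smooth_on U (F i)" and smooth_R: "smooth_on U (R i)" and smooth_X: "smooth_on U (X i)"
    and t_X: "x \<in> U \<Longrightarrow> t x (X i x) = F i x"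
    and d_X: "x \<in> U \<Longrightarrow> dform t x (X i x) v = R i x * t x v - D (F i) x v"
begin

definition br :: "'i \<Rightarrow> 'i \<Rightarrow> 'e \<Rightarrow> real" where
  "br i j x = D (F j) x (X i x) - F j x * R i x"

lemma linear_D_F: "x \<in> U \<Longrightarrow> linear (D (F i) x)"
  by (rule linear_D[OF smooth_on_imp_differentiable[OF smooth_F]])

lemma smooth_X_F: "smooth_on U (\<lambda>x. D (F j) x (X i x))"
  by (rule smooth_on_apply_field[OF U linear_D_F smooth_on_D[OF smooth_F] smooth_X])

lemma smooth_br: "smooth_on U (br i j)"
  unfolding br_def[abs_def] by (intro smooth_on_diff smooth_on_mult smooth_X_F smooth_F smooth_R U)

text \<open>Cartan's formula for \<open>d\<theta>(X\<^sub>f, X\<^sub>g)\<close> is compared with the equation that defines \<open>X\<^sub>f\<close>.\<close>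

lemma t_lie_bracket:
  assumes x: "x \<in> U"
  shows "t x (D (X j) x (X i x) - D (X i) x (X j x)) = br i j x"
proof -
  have "D (\<lambda>y. t y (X k y)) x = D (F k) x" for k
    by (rule D_cong_open[OF U x]) (rule t_X)
  then have "dform t x (X i x) (X j x) = D (F j) x (X i x) - D (F i) x (X j x)
      - t x (D (X j) x (X i x) - D (X i) x (X j x))"
    using dform_fields[OF x smooth_X smooth_X] by simp
  then show ?thesis using d_X[OF x, of i "X j x"] by (simp add: br_def t_X[OF x] mult.commute)
qed

text \<open>The defining equation of \<open>X\<^sub>h\<close> expresses \<open>d\<theta>([X\<^sub>f, X\<^sub>g], X\<^sub>h)\<close> through \<open>[X\<^sub>f, X\<^sub>g] h\<close> and \<open>{f, g}\<close>.\<close>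

lemma d_lie_bracket:
  assumes x: "x \<in> U"
  shows "dform t x (D (X j) x (X i x) - D (X i) x (X j x)) (X k x) =
    D (\<lambda>y. D (F k) y (X j y)) x (X i x) - D (\<lambda>y. D (F k) y (X i y)) x (X j x) - R k x * br i j x"
  using d_X[OF x, of k "D (X j) x (X i x) - D (X i) x (X j x)"]
    dform_antisym[of t x "X k x" "D (X j) x (X i x) - D (X i) x (X j x)"]
    D_D_field_commutator[OF U x smooth_F[of k] smooth_X[of i] smooth_X[of j]]
  by (simp add: t_lie_bracket[OF x])

lemma br_antisym:
  assumes "y \<in> U" shows "br i j y = - br j i y"
  using d_X[OF assms, of i "X j y"] d_X[OF assms, of j "X i y"] dform_antisym[of t y "X i y" "X j y"]
  by (simp add: br_def t_X[OF assms] mult.commute)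

text \<open>Evaluate \<open>d(d\<theta>) = 0\<close> on \<open>X\<^sub>f\<close>, \<open>X\<^sub>g\<close>, \<open>X\<^sub>h\<close> and write everything in terms of brackets and Reeb derivatives,
  using \<open>X\<^sub>g h = {g, h} + h \<xi>g\<close> and \<open>d\<theta>(X\<^sub>g, X\<^sub>h) = h \<xi>g - X\<^sub>h g\<close>. The terms of the form
  \<open>X\<^sub>f (h \<xi>g)\<close> cancel, and what is left is the cyclic sum.\<close>

lemma jacobi:
  assumes x: "x \<in> U"
  shows "(D (br j k) x (X i x) - br j k x * R i x) + (D (br k i) x (X j x) - br k i x * R j x)
    + (D (br i j) x (X k x) - br i j x * R k x) = 0"
proof -
  \<comment> \<open>\<open>X\<^sub>j F\<^sub>k = {F\<^sub>j, F\<^sub>k} + F\<^sub>k R\<^sub>j\<close>, differentiated\<close>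
  have br': "D (\<lambda>y. D (F k) y (X j y)) x v = D (br j k) x v + D (\<lambda>y. F k y * R j y) x v" for j k v
  proof -
    have "(\<lambda>y. D (F k) y (X j y)) = (\<lambda>y. br j k y + F k y * R j y)"
      by (simp add: br_def fun_eq_iff)
    moreover have "((\<lambda>y. br j k y + F k y * R j y) has_derivative
        (\<lambda>v. D (br j k) x v + D (\<lambda>y. F k y * R j y) x v)) (at x)"
      by (intro has_derivative_add has_derivative_D smooth_on_imp_differentiable[OF _ x]
          smooth_br smooth_on_mult smooth_F smooth_R U)
    ultimately show ?thesis by (simp add: D_eqI)
  qed
  \<comment> \<open>\<open>d\<theta>(X\<^sub>j, X\<^sub>k) = F\<^sub>k R\<^sub>j - X\<^sub>k F\<^sub>j\<close>, differentiated\<close>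
  have d': "D (\<lambda>y. dform t y (X j y) (X k y)) x v = D (\<lambda>y. F k y * R j y) x v - D (\<lambda>y. D (F j) y (X k y)) x v" for j k v
  proof -
    have "D (\<lambda>y. dform t y (X j y) (X k y)) x = D (\<lambda>y. F k y * R j y - D (F j) y (X k y)) x"
      by (rule D_cong_open[OF U x]) (simp add: d_X t_X)
    moreover have "((\<lambda>y. F k y * R j y - D (F j) y (X k y)) has_derivative
        (\<lambda>v. D (\<lambda>y. F k y * R j y) x v - D (\<lambda>y. D (F j) y (X k y)) x v)) (at x)"
      by (intro has_derivative_diff has_derivative_D smooth_on_imp_differentiable[OF _ x]
          smooth_X_F smooth_on_mult smooth_F smooth_R U)
    ultimately show ?thesis by (simp add: D_eqI)
  qed
  have D_anti: "D (br i j) x v = - D (br j i) x v" for i j v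
  proof -
    have "D (br i j) x = D (\<lambda>y. - br j i y) x" by (rule D_cong_open[OF U x]) (rule br_antisym)
    then show ?thesis
      using D_eqI[OF has_derivative_minus[OF has_derivative_D[OF smooth_on_imp_differentiable[OF smooth_br[of j i] x]]]]
      by simp
  qed
  show ?thesis
    using dform_closed_fields[OF x smooth_X[of i] smooth_X[of j] smooth_X[of k]]
    unfolding d_lie_bracket[OF x] d' br' D_anti[of k j] D_anti[of i k] D_anti[of j i]
    by (simp add: algebra_simps)
qed

end

section \<open>Charts and tangent vectors\<close>

locale atlas =
  fixes A :: "('a::topological_space, 'e::euclidean_space) chart set"
  assumes atlas: "smooth_atlas A"
begin

abbreviation overlap :: "('a, 'e) chart \<Rightarrow> ('a, 'e) chart \<Rightarrow> 'e set" where
  "overlap c d \<equiv> chart_map c ` (chart_dom c \<inter> chart_dom d)"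

lemma charts_atD: "c \<in> charts_at A p \<Longrightarrow> c \<in> A" "c \<in> charts_at A p \<Longrightarrow> p \<in> chart_dom c"
  by (auto simp: charts_at_def)

lemma chart_at_in: "chart_at A p \<in> charts_at A p"
proof -
  have "p \<in> (\<Union>c\<in>A. chart_dom c)" using atlas by (simp add: smooth_atlas_def)
  then have "\<exists>c. c \<in> charts_at A p" unfolding charts_at_def by blast
  then show ?thesis unfolding chart_at_def by (rule someI_ex)
qed

lemma is_chart: "c \<in> A \<Longrightarrow> is_chart c"
  using atlas by (simp add: smooth_atlas_def)

lemma open_chart_image: "c \<in> A \<Longrightarrow> open (chart_image c)"
  using is_chart by (simp add: is_chart_def)

lemma chart_inv_map: "c \<in> A \<Longrightarrow> p \<in> chart_dom c \<Longrightarrow> chart_inv c (chart_map c p) = p"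
  using is_chart[of c] by (simp add: is_chart_def homeomorphism_def)

lemma chart_map_inv: "c \<in> A \<Longrightarrow> x \<in> chart_image c \<Longrightarrow> chart_map c (chart_inv c x) = x"
  using is_chart[of c] by (simp add: is_chart_def homeomorphism_def)

lemma chart_inv_in: "c \<in> A \<Longrightarrow> x \<in> chart_image c \<Longrightarrow> chart_inv c x \<in> chart_dom c"
  using is_chart[of c] by (auto simp: is_chart_def homeomorphism_def)

lemma charts_at_chart_inv: "c \<in> A \<Longrightarrow> x \<in> chart_image c \<Longrightarrow> c \<in> charts_at A (chart_inv c x)"
  by (simp add: charts_at_def chart_inv_in)

lemma chart_map_in: "c \<in> charts_at A p \<Longrightarrow> chart_map c p \<in> chart_image c"
  by (auto simp: charts_at_def chart_image_def)

lemma chart_inv_map_at: "c \<in> charts_at A p \<Longrightarrow> chart_inv c (chart_map c p) = p"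
  by (auto simp: charts_at_def chart_inv_map)

text \<open>The overlap is measured in the coordinates of \<open>c\<close>; it is the domain of the transition map from \<open>c\<close> to \<open>d\<close>.\<close>

lemma open_overlap: "c \<in> A \<Longrightarrow> d \<in> A \<Longrightarrow> open (overlap c d)"
proof -
  assume c: "c \<in> A" and d: "d \<in> A"
  have "open (chart_dom c \<inter> chart_dom d)" using is_chart[OF c] is_chart[OF d] by (auto simp: is_chart_def)
  then have "openin (top_of_set (chart_dom c)) (chart_dom c \<inter> chart_dom d)"
    by (metis inf_left_idem openin_open_Int)
  then have "openin (top_of_set (chart_image c)) (overlap c d)"
    using is_chart[OF c] homeomorphism_imp_open_map unfolding is_chart_def by blast
  then show ?thesis using open_chart_image[OF c] openin_open_trans by blast
qed

lemma overlap_subset: "overlap c d \<subseteq> chart_image c"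
  by (auto simp: chart_image_def)

lemma in_overlap: "c \<in> charts_at A p \<Longrightarrow> d \<in> charts_at A p \<Longrightarrow> chart_map c p \<in> overlap c d"
  by (auto simp: charts_at_def)

lemma chart_inv_overlap:
  assumes "c \<in> A" "x \<in> overlap c d"
  shows "chart_inv c x \<in> chart_dom c" "chart_inv c x \<in> chart_dom d"
  using assms by (auto simp: chart_inv_map)

lemma smooth_transition: "c \<in> A \<Longrightarrow> d \<in> A \<Longrightarrow> smooth_on (overlap c d) (transition c d)"
  using atlas by (simp add: smooth_atlas_def)

lemma transition_map: "c \<in> charts_at A p \<Longrightarrow> transition c d (chart_map c p) = chart_map d p"
  by (simp add: transition_def chart_inv_map_at)

lemma chart_inv_transition:
  assumes "c \<in> A" "d \<in> A" "x \<in> overlap c d"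
  shows "chart_inv d (transition c d x) = chart_inv c x"
  using chart_inv_overlap[OF assms(1,3)] assms by (simp add: transition_def chart_inv_map)

lemma diff_transition:
  "c \<in> charts_at A p \<Longrightarrow> d \<in> charts_at A p \<Longrightarrow> transition c d differentiable at (chart_map c p)"
  by (rule smooth_on_imp_differentiable[OF smooth_transition in_overlap]) (auto dest: charts_atD)

lemma linear_D_transition:
  "c \<in> charts_at A p \<Longrightarrow> d \<in> charts_at A p \<Longrightarrow> linear (D (transition c d) (chart_map c p))"
  by (rule linear_D[OF diff_transition])

lemma D_transition_self:
  assumes c: "c \<in> charts_at A p"
  shows "D (transition c c) (chart_map c p) = (\<lambda>v. v)"
proof -
  have "D (transition c c) (chart_map c p) = D (\<lambda>x. x) (chart_map c p)"
    by (rule D_cong_open[OF open_chart_image[OF charts_atD(1)[OF c]] chart_map_in[OF c]])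
      (simp add: transition_def chart_map_inv charts_atD(1)[OF c])
  then show ?thesis by simp
qed

text \<open>The chain rule across a change of charts, for functions that need only agree near the point \<open>p\<close>.\<close>

lemma D_comp_transition:
  assumes c: "c \<in> charts_at A p" and d: "d \<in> charts_at A p"
    and g: "g differentiable at (chart_map d p)"
    and f: "\<And>x. x \<in> overlap c d \<Longrightarrow> chart_inv c x \<in> S \<Longrightarrow> f x = g (transition c d x)"
    and S: "open S" "p \<in> S"
  shows "D f (chart_map c p) v = D g (chart_map d p) (D (transition c d) (chart_map c p) v)"
proof -
  let ?x = "chart_map c p" 
  have cA: "c \<in> A" and dA: "d \<in> A" using c d by (auto dest: charts_atD)
  have "continuous_on (overlap c d) (chart_inv c)"
    using is_chart[OF cA] overlap_subset[of c d]
    by (auto simp: is_chart_def homeomorphism_def intro: continuous_on_subset)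
  then have "open (chart_inv c -` S \<inter> overlap c d)"
    using continuous_on_open_vimage[OF open_overlap[OF cA dA]] S by blast
  moreover have "?x \<in> chart_inv c -` S \<inter> overlap c d"
    using S(2) in_overlap[OF c d] by (simp add: chart_inv_map_at[OF c])
  moreover have "f y = (\<lambda>x. g (transition c d x)) y" if "y \<in> chart_inv c -` S \<inter> overlap c d" for y
    using f that by blast
  ultimately have "D f ?x = D (\<lambda>x. g (transition c d x)) ?x" by (rule D_cong_open)
  moreover have "((\<lambda>x. g (transition c d x)) has_derivative
      (\<lambda>v. D g (chart_map d p) (D (transition c d) ?x v))) (at ?x)"
    by (rule has_derivative_compose[OF has_derivative_D[OF diff_transition[OF c d]]])
      (simp add: transition_map[OF c] has_derivative_D[OF g])
  ultimately show ?thesis by (simp add: D_eqI)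
qed

lemma D_transition_cocycle:
  assumes c: "c \<in> charts_at A p" and d: "d \<in> charts_at A p" and e: "e \<in> charts_at A p"
  shows "D (transition c e) (chart_map c p) v =
    D (transition d e) (chart_map d p) (D (transition c d) (chart_map c p) v)"
proof (rule D_comp_transition[OF c d diff_transition[OF d e], of UNIV])
  have cA: "c \<in> A" and dA: "d \<in> A" using c d by (auto dest: charts_atD)
  show "transition c e x = transition d e (transition c d x)" if "x \<in> overlap c d" for x
    using chart_inv_transition[OF cA dA that] by (simp add: transition_def)
qed auto

text \<open>The compatibility between the charts is the chain rule for composed transition maps.\<close>

lemma coord_vec_in_tangent:
  assumes c: "c \<in> charts_at A p"
  shows "coord_vec A c p e \<in> tangent_space A p"
  unfolding tangent_space_def coord_vec_def mem_Collect_eq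
  by (intro conjI ballI allI impI) (simp_all, rule D_transition_cocycle[OF c])

lemma tangent_coords:
  "v \<in> tangent_space A p \<Longrightarrow> c \<in> charts_at A p \<Longrightarrow> d \<in> charts_at A p \<Longrightarrow>
    v d = D (transition c d) (chart_map c p) (v c)"
  unfolding tangent_space_def by blast

lemma tangent_outside: "v \<in> tangent_space A p \<Longrightarrow> c \<notin> charts_at A p \<Longrightarrow> v c = 0"
  unfolding tangent_space_def by blast

lemma coord_vec_self: "c \<in> charts_at A p \<Longrightarrow> coord_vec A c p e c = e"
  by (simp add: coord_vec_def D_transition_self)

lemma coord_vec_coords:
  "c \<in> charts_at A p \<Longrightarrow> v \<in> tangent_space A p \<Longrightarrow> coord_vec A c p (v c) = v"
  unfolding coord_vec_def by (rule ext) (metis tangent_coords tangent_outside)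

lemma coord_vec_add:
  "c \<in> charts_at A p \<Longrightarrow> coord_vec A c p (e + e') = coord_vec A c p e + coord_vec A c p e'"
  by (auto simp: coord_vec_def fun_eq_iff linear_add[OF linear_D_transition])

lemma coord_vec_scale:
  "c \<in> charts_at A p \<Longrightarrow> coord_vec A c p (r *\<^sub>R e) = tscale r (coord_vec A c p e)"
  by (auto simp: coord_vec_def fun_eq_iff linear_cmul[OF linear_D_transition])

lemma tangent_add:
  assumes "v \<in> tangent_space A p" "w \<in> tangent_space A p"
  shows "v + w \<in> tangent_space A p"
proof -
  have "v + w = coord_vec A (chart_at A p) p (v (chart_at A p) + w (chart_at A p))"
    using assms by (simp add: coord_vec_add[OF chart_at_in] coord_vec_coords[OF chart_at_in])
  then show ?thesis by (simp only: coord_vec_in_tangent[OF chart_at_in])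
qed

lemma tangent_scale:
  assumes "v \<in> tangent_space A p"
  shows "tscale r v \<in> tangent_space A p"
proof -
  have "tscale r v = coord_vec A (chart_at A p) p (r *\<^sub>R v (chart_at A p))"
    using assms by (simp add: coord_vec_scale[OF chart_at_in] coord_vec_coords[OF chart_at_in])
  then show ?thesis by (simp only: coord_vec_in_tangent[OF chart_at_in])
qed

section \<open>Smooth functions and directional derivatives\<close>

lemma smooth_functions_local:
  "f \<in> smooth_functions A \<Longrightarrow> c \<in> A \<Longrightarrow> smooth_on (chart_image c) (f \<circ> chart_inv c)"
  by (simp add: smooth_functions_def)

lemma smooth_functions_diff:
  "f \<in> smooth_functions A \<Longrightarrow> c \<in> charts_at A p \<Longrightarrow> (f \<circ> chart_inv c) differentiable at (chart_map c p)"
  by (rule smooth_on_imp_differentiable[OF smooth_functions_local chart_map_in]) (auto dest: charts_atD)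

text \<open>The definition computes in one arbitrarily chosen chart; by the chain rule any chart around \<open>p\<close> will do.\<close>

lemma dir_deriv_chart:
  assumes f: "f \<in> smooth_functions A" and v: "v \<in> tangent_space A p" and c: "c \<in> charts_at A p"
  shows "dir_deriv A p v f = D (f \<circ> chart_inv c) (chart_map c p) (v c)"
proof -
  define d where "d = chart_at A p"
  have d: "d \<in> charts_at A p" unfolding d_def by (rule chart_at_in)
  have "D (f \<circ> chart_inv d) (chart_map d p) (v d)
      = D (f \<circ> chart_inv c) (chart_map c p) (D (transition d c) (chart_map d p) (v d))"
    by (rule D_comp_transition[OF d c smooth_functions_diff[OF f c], of UNIV])
      (simp_all add: chart_inv_transition charts_atD(1)[OF c] charts_atD(1)[OF d])
  then show ?thesis using tangent_coords[OF v d c] by (simp add: dir_deriv_def d_def Let_def)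
qed

lemma smooth_functions_const: "(\<lambda>p. r) \<in> smooth_functions A"
  by (auto simp: smooth_functions_def o_def smooth_on_const)

lemma smooth_functions_add:
  "f \<in> smooth_functions A \<Longrightarrow> g \<in> smooth_functions A \<Longrightarrow> f + g \<in> smooth_functions A"
  by (auto simp: smooth_functions_def o_def intro!: smooth_on_add open_chart_image)

lemma smooth_functions_mult:
  "f \<in> smooth_functions A \<Longrightarrow> g \<in> smooth_functions A \<Longrightarrow> f * g \<in> smooth_functions A"
  by (auto simp: smooth_functions_def o_def intro!: smooth_on_mult open_chart_image)

lemma smooth_functions_scale:
  "f \<in> smooth_functions A \<Longrightarrow> fscale r f \<in> smooth_functions A"
  using smooth_functions_mult[OF smooth_functions_const[of r]] by (simp add: times_fun_def)

lemma dir_deriv_const: "dir_deriv A p v (\<lambda>p. r) = 0"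
  by (simp add: dir_deriv_def o_def Let_def)

lemma dir_deriv_add:
  assumes "f \<in> smooth_functions A" "g \<in> smooth_functions A"
  shows "dir_deriv A p v (f + g) = dir_deriv A p v f + dir_deriv A p v g"
  using D_eqI[OF has_derivative_add[OF assms[THEN smooth_functions_diff[OF _ chart_at_in, THEN has_derivative_D]]]]
  by (simp add: dir_deriv_def Let_def o_def)

lemma dir_deriv_mult:
  assumes "f \<in> smooth_functions A" "g \<in> smooth_functions A"
  shows "dir_deriv A p v (f * g) = f p * dir_deriv A p v g + dir_deriv A p v f * g p"
  using D_eqI[OF has_derivative_mult[OF assms[THEN smooth_functions_diff[OF _ chart_at_in, THEN has_derivative_D]]]]
  by (simp add: dir_deriv_def Let_def o_def chart_inv_map_at[OF chart_at_in])

lemma dir_deriv_scale: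
  assumes "f \<in> smooth_functions A"
  shows "dir_deriv A p v (fscale r f) = r * dir_deriv A p v f"
  using dir_deriv_mult[OF smooth_functions_const[of r] assms] by (simp add: dir_deriv_const times_fun_def)

section \<open>One-forms in charts\<close>

context
  fixes \<theta> :: "'a \<Rightarrow> ('a, 'e) tvec \<Rightarrow> real"
  assumes \<theta>: "one_form A \<theta>"
begin

lemma open_form_chart:
  assumes c: "c \<in> A"
  shows "open_form (chart_image c) (local_form A \<theta> c)"
proof (rule open_form.intro)
  fix x assume x: "x \<in> chart_image c"
  note ci = charts_at_chart_inv[OF c x]
  have "cotangent A (chart_inv c x) (\<theta> (chart_inv c x))" using \<theta> unfolding one_form_def by blast
  then show "linear (local_form A \<theta> c x)" unfolding local_form_def cotangent_def
    by (intro linearI) (simp_all add: coord_vec_add[OF ci] coord_vec_scale[OF ci] coord_vec_in_tangent[OF ci])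
qed (use \<theta> c open_chart_image in \<open>auto simp: one_form_def\<close>)

lemma local_form_at:
  "c \<in> charts_at A p \<Longrightarrow> v \<in> tangent_space A p \<Longrightarrow> local_form A \<theta> c (chart_map c p) (v c) = \<theta> p v"
  by (simp add: local_form_def chart_inv_map_at coord_vec_coords)

lemma local_form_transition:
  assumes c: "c \<in> A" and d: "d \<in> A" and x: "x \<in> overlap c d"
  shows "local_form A \<theta> c x e = local_form A \<theta> d (transition c d x) (D (transition c d) x e)"
proof -
  define p where "p = chart_inv c x"
  have p: "c \<in> charts_at A p" "d \<in> charts_at A p" "chart_map c p = x"
    using chart_inv_overlap[OF c x] c d x by (auto simp: p_def charts_at_def chart_inv_map)
  let ?v = "coord_vec A c p e"
  have v: "?v \<in> tangent_space A p" by (rule coord_vec_in_tangent[OF p(1)])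
  have "D (transition c d) x e = ?v d"
    using tangent_coords[OF v p(1,2)] by (simp add: coord_vec_self[OF p(1)] p(3))
  then show ?thesis
    using local_form_at[OF p(1) v] local_form_at[OF p(2) v] transition_map[OF p(1), of d] p(3)
    by (simp add: coord_vec_self[OF p(1)])
qed

text \<open>Exterior differentiation commutes with pullback along the transition map \<open>\<tau>\<close>. Differentiating
  \<open>\<theta>\<^sub>c(x)(w) = \<theta>\<^sub>d(\<tau> x)(D\<tau>(x) w)\<close> gives a term with the second derivative of \<open>\<tau>\<close>, which is symmetric and
  disappears in the alternating combination.\<close>

lemma dform_transition:
  assumes c: "c \<in> charts_at A p" and d: "d \<in> charts_at A p"
  shows "dform (local_form A \<theta> c) (chart_map c p) v w =
    dform (local_form A \<theta> d) (chart_map d p) (D (transition c d) (chart_map c p) v) (D (transition c d) (chart_map c p) w)"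
proof -
  let ?x = "chart_map c p" and ?\<tau> = "transition c d"
  have cA: "c \<in> A" and dA: "d \<in> A" using c d by (auto dest: charts_atD)
  interpret d: open_form "chart_image d" "local_form A \<theta> d" by (rule open_form_chart[OF dA])
  have S: "open (overlap c d)" "?x \<in> overlap c d" using open_overlap[OF cA dA] in_overlap[OF c d] by auto
  have \<tau>_in: "?\<tau> y \<in> chart_image d" if "y \<in> overlap c d" for y
    using chart_inv_overlap[OF cA that] by (auto simp: transition_def chart_image_def)
  have \<tau>x: "?\<tau> ?x = chart_map d p" by (rule transition_map[OF c])
  have dL: "((\<lambda>y. local_form A \<theta> d (?\<tau> y) e) has_derivative
      (\<lambda>v. D (\<lambda>y. local_form A \<theta> d y e) (chart_map d p) (D ?\<tau> ?x v))) (at ?x)" for e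
    by (rule has_derivative_compose[OF has_derivative_D[OF diff_transition[OF c d]]])
      (simp add: \<tau>x has_derivative_D[OF d.diff_t[OF chart_map_in[OF d]]])
  have dY: "(\<lambda>y. D ?\<tau> y w) differentiable at ?x" for w
    by (rule smooth_on_imp_differentiable[OF smooth_on_D[OF smooth_transition[OF cA dA]] S(2)])
  have "D (\<lambda>y. local_form A \<theta> c y w) ?x v =
      D (\<lambda>y. local_form A \<theta> d y (D ?\<tau> ?x w)) (chart_map d p) (D ?\<tau> ?x v)
      + local_form A \<theta> d (chart_map d p) (D (\<lambda>y. D ?\<tau> y w) ?x v)" for v w
  proof -
    have "D (\<lambda>y. local_form A \<theta> c y w) ?x = D (\<lambda>y. local_form A \<theta> d (?\<tau> y) (D ?\<tau> y w)) ?x"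
      by (rule D_cong_open[OF S]) (rule local_form_transition[OF cA dA])
    moreover have "((\<lambda>y. local_form A \<theta> d (?\<tau> y) (D ?\<tau> y w)) has_derivative
        (\<lambda>v. D (\<lambda>y. local_form A \<theta> d (?\<tau> y) (D ?\<tau> ?x w)) ?x v
          + local_form A \<theta> d (?\<tau> ?x) (D (\<lambda>y. D ?\<tau> y w) ?x v))) (at ?x)"
      by (rule has_derivative_apply_field[OF S d.linear_t[OF \<tau>_in] _ dY])
        (use dL in \<open>auto simp: differentiable_def\<close>)
    ultimately show ?thesis by (simp add: D_eqI D_eqI[OF dL] \<tau>x)
  qed
  then show ?thesis
    using second_derivative_symmetric[OF S smooth_transition[OF cA dA], of v w]
    by (simp add: dform_def)
qed

lemma ext_deriv_chart:
  assumes c: "c \<in> charts_at A p" and v: "v \<in> tangent_space A p" and w: "w \<in> tangent_space A p"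
  shows "ext_deriv A \<theta> p v w = dform (local_form A \<theta> c) (chart_map c p) (v c) (w c)"
proof -
  define d where "d = chart_at A p"
  have d: "d \<in> charts_at A p" unfolding d_def by (rule chart_at_in)
  have "ext_deriv A \<theta> p v w = dform (local_form A \<theta> d) (chart_map d p) (v d) (w d)"
    by (simp add: ext_deriv_def Let_def dform_def d_def)
  then show ?thesis
    using dform_transition[OF d c, of "v d" "w d"] tangent_coords[OF v d c] tangent_coords[OF w d c] by simp
qed

end

end

section \<open>The Reeb field and Hamiltonian vector fields\<close>

locale contact_manifold = atlas A for A :: "('a::topological_space, real ^ 'm) chart set" +
  fixes \<theta> :: "'a \<Rightarrow> ('a, real ^ 'm) tvec \<Rightarrow> real" and n :: nat
  assumes dim: "CARD('m) = 2 * n + 1" and contact: "contact_form n A \<theta>"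
begin

abbreviation lf :: "('a, real ^ 'm) chart \<Rightarrow> real ^ 'm \<Rightarrow> real ^ 'm \<Rightarrow> real" where
  "lf \<equiv> local_form A \<theta>"

lemma one_form: "one_form A \<theta>"
  using contact by (simp add: contact_form_def)

lemmas open_form_lf = open_form_chart[OF one_form]
  and lf_at = local_form_at[OF one_form]
  and ext_deriv_lf = ext_deriv_chart[OF one_form]

text \<open>The contact condition is transported to the coordinate space of the chart, where it says that
  \<open>\<theta>\<close> and \<open>d\<theta>\<close> have no common kernel.\<close>

lemma linear_contact_at:
  assumes c: "c \<in> charts_at A p"
  shows "linear_contact (lf c (chart_map c p)) (dform (lf c) (chart_map c p))"
proof -
  let ?x = "chart_map c p"
  interpret open_form "chart_image c" "lf c" by (rule open_form_lf[OF charts_atD(1)[OF c]])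
  note x = chart_map_in[OF c]
  obtain v where v: "\<And>i. i < 2 * n + 1 \<Longrightarrow> v i \<in> tangent_space A p"
    and nz: "wedge 1 (2 * n) (\<lambda>u. \<theta> p (u 0)) (wedge_power 2 (\<lambda>u. ext_deriv A \<theta> p (u 0) (u 1)) n) v \<noteq> 0"
    using contact unfolding contact_form_def by blast
  let ?R = "\<lambda>v e. v \<in> tangent_space A p \<and> e = v c"
  have "wedge 1 (2 * n) (\<lambda>u. \<theta> p (u 0)) (wedge_power 2 (\<lambda>u. ext_deriv A \<theta> p (u 0) (u 1)) n) v
    = wedge 1 (2 * n) (\<lambda>u. lf c ?x (u 0)) (wedge_power 2 (\<lambda>u. dform (lf c) ?x (u 0) (u 1)) n) (\<lambda>i. v i c)"
  proof (rule wedge_transfer[where R = ?R])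
    fix u u' assume "\<And>i. i < 2 * n \<Longrightarrow> ?R (u i) (u' i)"
    then show "wedge_power 2 (\<lambda>u. ext_deriv A \<theta> p (u 0) (u 1)) n u
        = wedge_power 2 (\<lambda>u. dform (lf c) ?x (u 0) (u 1)) n u'"
      by (intro wedge_power_transfer[where R = ?R]) (auto simp: ext_deriv_lf[OF c] mult.commute)
  qed (use v in \<open>auto simp: lf_at[OF c]\<close>)
  with nz have nz': "wedge 1 (2 * n) (\<lambda>u. lf c ?x (u 0))
      (wedge_power 2 (\<lambda>u. dform (lf c) ?x (u 0) (u 1)) n) (\<lambda>i. v i c) \<noteq> 0" by simp
  have D: "DIM(real ^ 'm) = 2 * n + 1" using dim by simp
  show ?thesis
    by (rule linear_contact.intro)
      (rule linear_t[OF x] bilinear_dform[OF x] dform_antisym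
        contact_condition_nondegenerate[OF linear_t[OF x] bilinear_dform[OF x] dform_antisym D nz'], assumption?)+
qed

text \<open>The difference of the two vectors lies in the common kernel of \<open>\<theta>\<close> and \<open>d\<theta>\<close>. This gives uniqueness in the
  definite descriptions of the Reeb field and of \<open>\<Lambda>\<^sup>#\<close>.\<close>

lemma tangent_eqI:
  assumes v: "v \<in> tangent_space A p" and w: "w \<in> tangent_space A p"
    and t: "\<theta> p v = \<theta> p w"
    and d: "\<And>u. u \<in> tangent_space A p \<Longrightarrow> ext_deriv A \<theta> p v u = ext_deriv A \<theta> p w u"
  shows "v = w"
proof -
  define c where "c = chart_at A p"
  have c: "c \<in> charts_at A p" unfolding c_def by (rule chart_at_in)
  interpret linear_contact "lf c (chart_map c p)" "dform (lf c) (chart_map c p)"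
    by (rule linear_contact_at[OF c])
  have "v c - w c = 0"
  proof (rule nondegenerate)
    show "lf c (chart_map c p) (v c - w c) = 0"
      using t by (simp add: linear_diff[OF a] lf_at[OF c v] lf_at[OF c w])
    fix e
    have "ext_deriv A \<theta> p v (coord_vec A c p e) = ext_deriv A \<theta> p w (coord_vec A c p e)"
      by (rule d[OF coord_vec_in_tangent[OF c]])
    then show "dform (lf c) (chart_map c p) (v c - w c) e = 0"
      by (simp add: ext_deriv_lf[OF c _ coord_vec_in_tangent[OF c]] v w coord_vec_self[OF c] bilinear_lsub[OF b])
  qed
  then have "v c = w c" by simp
  then show ?thesis using coord_vec_coords[OF c v] coord_vec_coords[OF c w] by metis
qed

lemma linear_contact_in_chart: "c \<in> A \<Longrightarrow> x \<in> chart_image c \<Longrightarrow>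
    linear_contact (lf c x) (dform (lf c) x)"
  using linear_contact_at[OF charts_at_chart_inv] chart_map_inv by metis

text \<open>The coefficients of the invertible system given by the pairing \<open>d\<theta> + \<theta> \<otimes> \<theta>\<close> are smooth, so a field that
  solves it with a smooth right-hand side is smooth.\<close>

lemma smooth_field:
  assumes c: "c \<in> A" and r: "\<And>x. x \<in> chart_image c \<Longrightarrow> linear (r x)"
    and sr: "\<And>v. smooth_on (chart_image c) (\<lambda>x. r x v)"
    and X: "\<And>x v. x \<in> chart_image c \<Longrightarrow> dform (lf c) x (X x) v + lf c x (X x) * lf c x v = r x v"
  shows "smooth_on (chart_image c) X"
proof -
  interpret open_form "chart_image c" "lf c" by (rule open_form_lf[OF c])
  let ?b = "\<lambda>x. linear_contact.pairing (lf c x) (dform (lf c) x)"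
  let ?b' = "\<lambda>x w v. dform (lf c) x w v + lf c x w * lf c x v"
  have b: "?b x = ?b' x" if "x \<in> chart_image c" for x
    using linear_contact.pairing_def[OF linear_contact_in_chart[OF c that]] by (simp add: fun_eq_iff)
  show ?thesis
  proof (rule smooth_on_solution[of "chart_image c" ?b' r])
    show "bilinear (?b' x)" if "x \<in> chart_image c" for x
      using linear_contact.bilinear_pairing[OF linear_contact_in_chart[OF c that]] b[OF that] by simp
    show "w = 0" if "x \<in> chart_image c" "\<And>v. ?b' x w v = 0" for x w
      by (rule linear_contact.pairing_nondegenerate[OF linear_contact_in_chart[OF c that(1)]])
        (use that in \<open>simp add: b\<close>)
    show "smooth_on (chart_image c) (\<lambda>x. ?b' x v w)" for v w
      by (intro smooth_on_add smooth_on_mult smooth_dform smooth_t U)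
  qed (use U r sr X in auto)
qed

lemma reeb_exists_at:
  "\<exists>!\<xi>. \<xi> \<in> tangent_space A p \<and> \<theta> p \<xi> = 1 \<and> (\<forall>v\<in>tangent_space A p. ext_deriv A \<theta> p \<xi> v = 0)"
proof (rule ex_ex1I)
  define c where "c = chart_at A p"
  have c: "c \<in> charts_at A p" unfolding c_def by (rule chart_at_in)
  have "odd CARD('m)" using dim by simp
  from linear_contact.reeb_exists[OF linear_contact_at[OF c] this]
  obtain e where e: "lf c (chart_map c p) e = 1" "\<And>v. dform (lf c) (chart_map c p) e v = 0" by blast
  note ce = coord_vec_in_tangent[OF c, of e]
  show "\<exists>\<xi>. \<xi> \<in> tangent_space A p \<and> \<theta> p \<xi> = 1 \<and> (\<forall>v\<in>tangent_space A p. ext_deriv A \<theta> p \<xi> v = 0)"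
    using lf_at[OF c ce] ext_deriv_lf[OF c ce] ce e
    by (intro exI[of _ "coord_vec A c p e"]) (simp add: coord_vec_self[OF c])
next
  fix v w assume "v \<in> tangent_space A p \<and> \<theta> p v = 1 \<and> (\<forall>u\<in>tangent_space A p. ext_deriv A \<theta> p v u = 0)"
    and "w \<in> tangent_space A p \<and> \<theta> p w = 1 \<and> (\<forall>u\<in>tangent_space A p. ext_deriv A \<theta> p w u = 0)"
  then show "v = w" by (intro tangent_eqI[of v p w]) simp_all
qed

text \<open>The Reeb field is described as a smooth field, but it is unique already as a pointwise solution.
  In the pairing \<open>d\<theta> + \<theta> \<otimes> \<theta>\<close> it solves the system with right-hand side \<open>\<theta>\<close>, which makes it smooth.\<close>

lemma reeb_unique:
  "\<exists>!\<xi>. vector_field A \<xi> \<and> (\<forall>p. \<theta> p (\<xi> p) = 1 \<and> (\<forall>v\<in>tangent_space A p. ext_deriv A \<theta> p (\<xi> p) v = 0))"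
proof (rule ex_ex1I)
  define \<xi> where "\<xi> p = (THE \<xi>. \<xi> \<in> tangent_space A p \<and> \<theta> p \<xi> = 1 \<and>
    (\<forall>v\<in>tangent_space A p. ext_deriv A \<theta> p \<xi> v = 0))" for p
  have "\<xi> p \<in> tangent_space A p \<and> \<theta> p (\<xi> p) = 1 \<and> (\<forall>v\<in>tangent_space A p. ext_deriv A \<theta> p (\<xi> p) v = 0)" for p
    unfolding \<xi>_def by (rule theI'[OF reeb_exists_at])
  then have \<xi>: "\<And>p. \<xi> p \<in> tangent_space A p" "\<And>p. \<theta> p (\<xi> p) = 1"
      "\<And>p v. v \<in> tangent_space A p \<Longrightarrow> ext_deriv A \<theta> p (\<xi> p) v = 0"
    by blast+
  have "smooth_on (chart_image c) (\<lambda>x. \<xi> (chart_inv c x) c)" if c: "c \<in> A" for c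
  proof (rule smooth_field[OF c, of "lf c"])
    interpret open_form "chart_image c" "lf c" by (rule open_form_lf[OF c])
    show "linear (lf c x)" if "x \<in> chart_image c" for x using that by (rule linear_t)
    show "smooth_on (chart_image c) (\<lambda>x. lf c x v)" for v by (rule smooth_t)
    fix x v assume x: "x \<in> chart_image c"
    note ci = charts_at_chart_inv[OF c x]
    show "dform (lf c) x (\<xi> (chart_inv c x) c) v + lf c x (\<xi> (chart_inv c x) c) * lf c x v = lf c x v"
      using lf_at[OF ci \<xi>(1)] ext_deriv_lf[OF ci \<xi>(1) coord_vec_in_tangent[OF ci, of v]]
        \<xi>(2)[of "chart_inv c x"] \<xi>(3)[OF coord_vec_in_tangent[OF ci, of v]]
      by (simp add: chart_map_inv[OF c x] coord_vec_self[OF ci])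
  qed
  then show "\<exists>\<xi>. vector_field A \<xi> \<and> (\<forall>p. \<theta> p (\<xi> p) = 1 \<and> (\<forall>v\<in>tangent_space A p. ext_deriv A \<theta> p (\<xi> p) v = 0))"
    using \<xi> unfolding vector_field_def by (intro exI[of _ \<xi>]) simp
next
  fix \<xi> \<xi>' assume 1: "vector_field A \<xi> \<and> (\<forall>p. \<theta> p (\<xi> p) = 1 \<and> (\<forall>v\<in>tangent_space A p. ext_deriv A \<theta> p (\<xi> p) v = 0))"
    and 2: "vector_field A \<xi>' \<and> (\<forall>p. \<theta> p (\<xi>' p) = 1 \<and> (\<forall>v\<in>tangent_space A p. ext_deriv A \<theta> p (\<xi>' p) v = 0))"
  show "\<xi> = \<xi>'"
  proof
    fix p
    show "\<xi> p = \<xi>' p"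
      using 1 2 by (intro tangent_eqI[of "\<xi> p" p "\<xi>' p"]) (simp_all add: vector_field_def)
  qed
qed

abbreviation reeb :: "'a \<Rightarrow> ('a, real ^ 'm) tvec" where
  "reeb \<equiv> reeb_field A \<theta>"

lemma reeb_spec:
  "vector_field A reeb \<and> (\<forall>p. \<theta> p (reeb p) = 1 \<and> (\<forall>v\<in>tangent_space A p. ext_deriv A \<theta> p (reeb p) v = 0))"
  unfolding reeb_field_def by (rule theI'[OF reeb_unique])

lemma reeb_in_tangent: "reeb p \<in> tangent_space A p"
  and reeb_smooth: "c \<in> A \<Longrightarrow> smooth_on (chart_image c) (\<lambda>x. reeb (chart_inv c x) c)"
  and theta_reeb: "\<theta> p (reeb p) = 1"
  and ext_deriv_reeb: "v \<in> tangent_space A p \<Longrightarrow> ext_deriv A \<theta> p (reeb p) v = 0"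
  using reeb_spec unfolding vector_field_def by blast+

lemma Lambda_sharp_spec:
  fixes p :: 'a
  assumes f: "f \<in> smooth_functions A"
  defines "w \<equiv> Lambda_sharp A \<theta> p (differential A f p)"
  shows "w \<in> tangent_space A p \<and> \<theta> p w = 0 \<and>
    (\<forall>v\<in>tangent_space A p. ext_deriv A \<theta> p w v = dir_deriv A p (reeb p) f * \<theta> p v - dir_deriv A p v f)"
proof -
  define c where "c = chart_at A p"
  have c: "c \<in> charts_at A p" unfolding c_def by (rule chart_at_in)
  let ?\<eta> = "D (f \<circ> chart_inv c) (chart_map c p)"
  let ?P = "\<lambda>w. w \<in> tangent_space A p \<and> \<theta> p w = 0 \<and>
    (\<forall>v\<in>tangent_space A p. ext_deriv A \<theta> p w v = dir_deriv A p (reeb p) f * \<theta> p v - dir_deriv A p v f)"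
  have "dform (lf c) (chart_map c p) (reeb p c) e = 0" for e
    using ext_deriv_reeb[OF coord_vec_in_tangent[OF c, of e]]
    by (simp add: ext_deriv_lf[OF c reeb_in_tangent coord_vec_in_tangent[OF c]] coord_vec_self[OF c])
  moreover have "lf c (chart_map c p) (reeb p c) = 1"
    by (simp add: lf_at[OF c reeb_in_tangent] theta_reeb)
  ultimately obtain e where e: "lf c (chart_map c p) e = 0"
      "\<And>v. dform (lf c) (chart_map c p) e v = ?\<eta> (reeb p c) * lf c (chart_map c p) v - ?\<eta> v"
    using linear_contact.sharp_exists[OF linear_contact_at[OF c] _ _ linear_D[OF smooth_functions_diff[OF f c]]]
    by blast
  note ce = coord_vec_in_tangent[OF c, of e]
  have "?P (coord_vec A c p e)"
    using lf_at[OF c ce] ext_deriv_lf[OF c ce] ce e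
    by (simp add: coord_vec_self[OF c] dir_deriv_chart[OF f _ c] reeb_in_tangent lf_at[OF c])
  moreover have "w = w'" if "?P w" "?P w'" for w w'
    using that by (intro tangent_eqI[of w p w']) simp_all
  ultimately have "\<exists>!w. ?P w" by blast
  then have "?P (THE w. ?P w)" by (rule theI')
  then show ?thesis unfolding w_def Lambda_sharp_def differential_def .
qed

abbreviation ham :: "('a \<Rightarrow> real) \<Rightarrow> 'a \<Rightarrow> ('a, real ^ 'm) tvec" where
  "ham \<equiv> hamiltonian_field A \<theta>"

abbreviation xi_deriv :: "('a \<Rightarrow> real) \<Rightarrow> 'a \<Rightarrow> real" where
  "xi_deriv f p \<equiv> dir_deriv A p (reeb p) f"

lemma ham_in_tangent:
  assumes "f \<in> smooth_functions A" shows "ham f p \<in> tangent_space A p"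
  unfolding hamiltonian_field_def using Lambda_sharp_spec[OF assms]
  by (simp add: tangent_add tangent_scale reeb_in_tangent)

text \<open>The two equations that \<open>X\<^sub>f = \<Lambda>\<^sup>#(df) + f \<xi>\<close> inherits from \<open>\<Lambda>\<^sup>#\<close> and \<open>\<xi>\<close>: \<open>\<theta>(X\<^sub>f) = f\<close> and
  \<open>d\<theta>(X\<^sub>f, \<cdot>) = (\<xi>f) \<theta> - df\<close>.\<close>

lemma ham_chart:
  assumes f: "f \<in> smooth_functions A" and c: "c \<in> charts_at A p"
  shows "lf c (chart_map c p) (ham f p c) = f p"
    and "dform (lf c) (chart_map c p) (ham f p c) e =
      xi_deriv f p * lf c (chart_map c p) e - D (f \<circ> chart_inv c) (chart_map c p) e"
proof -
  let ?x = "chart_map c p" and ?w = "Lambda_sharp A \<theta> p (differential A f p)"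
  interpret linear_contact "lf c ?x" "dform (lf c) ?x" by (rule linear_contact_at[OF c])
  have hc: "ham f p c = ?w c + f p *\<^sub>R reeb p c" by (simp add: hamiltonian_field_def)
  have w: "?w \<in> tangent_space A p" "\<theta> p ?w = 0"
    and dw: "\<And>v. v \<in> tangent_space A p \<Longrightarrow> ext_deriv A \<theta> p ?w v = xi_deriv f p * \<theta> p v - dir_deriv A p v f"
    using Lambda_sharp_spec[OF f, of p] by auto
  show "lf c ?x (ham f p c) = f p"
    by (simp add: hc linear_add[OF a] linear_cmul[OF a] lf_at[OF c w(1)] w(2) lf_at[OF c reeb_in_tangent] theta_reeb)
  let ?v = "coord_vec A c p e"
  have v: "?v \<in> tangent_space A p" by (rule coord_vec_in_tangent[OF c])
  have "dform (lf c) ?x (?w c) e = xi_deriv f p * lf c ?x e - D (f \<circ> chart_inv c) ?x e"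
    using dw[OF v] lf_at[OF c v] dir_deriv_chart[OF f v c]
    by (simp add: ext_deriv_lf[OF c w(1) v] coord_vec_self[OF c])
  moreover have "dform (lf c) ?x (reeb p c) e = 0"
    using ext_deriv_reeb[OF v] by (simp add: ext_deriv_lf[OF c reeb_in_tangent v] coord_vec_self[OF c])
  ultimately show "dform (lf c) ?x (ham f p c) e = xi_deriv f p * lf c ?x e - D (f \<circ> chart_inv c) ?x e"
    by (simp add: hc bilinear_ladd[OF b] bilinear_lmul[OF b])
qed

lemma smooth_functions_D_field:
  assumes f: "f \<in> smooth_functions A" and c: "c \<in> A" and X: "smooth_on (chart_image c) X"
  shows "smooth_on (chart_image c) (\<lambda>x. D (f \<circ> chart_inv c) x (X x))"
  by (rule smooth_on_apply_field[OF open_chart_image[OF c] linear_D smooth_on_D X])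
    (use smooth_functions_local[OF f c] in \<open>auto intro: smooth_on_imp_differentiable\<close>)

lemma xi_deriv_chart:
  assumes f: "f \<in> smooth_functions A" and c: "c \<in> A" and x: "x \<in> chart_image c"
  shows "xi_deriv f (chart_inv c x) = D (f \<circ> chart_inv c) x (reeb (chart_inv c x) c)"
  using dir_deriv_chart[OF f reeb_in_tangent charts_at_chart_inv[OF c x]] by (simp add: chart_map_inv[OF c x])

lemma xi_deriv_smooth:
  assumes f: "f \<in> smooth_functions A" shows "xi_deriv f \<in> smooth_functions A"
  unfolding smooth_functions_def
proof (intro CollectI ballI)
  fix c assume c: "c \<in> A"
  show "smooth_on (chart_image c) (xi_deriv f \<circ> chart_inv c)"
    by (subst smooth_on_cong[OF open_chart_image[OF c], of _ "\<lambda>x. D (f \<circ> chart_inv c) x (reeb (chart_inv c x) c)"])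
      (simp_all add: xi_deriv_chart[OF f c] smooth_functions_D_field[OF f c reeb_smooth[OF c]])
qed

text \<open>By its two equations, \<open>X\<^sub>f\<close> solves the system of the pairing with right-hand side
  \<open>(\<xi>f + f) \<theta> - df\<close>.\<close>

lemma ham_smooth:
  assumes f: "f \<in> smooth_functions A" and c: "c \<in> A"
  shows "smooth_on (chart_image c) (\<lambda>x. ham f (chart_inv c x) c)"
proof (rule smooth_field[OF c])
  let ?r = "\<lambda>x v. ((xi_deriv f \<circ> chart_inv c) x + (f \<circ> chart_inv c) x) * lf c x v - D (f \<circ> chart_inv c) x v"
  interpret open_form "chart_image c" "lf c" by (rule open_form_lf[OF c])
  note sf = smooth_functions_local[OF f c]
  show "smooth_on (chart_image c) (\<lambda>x. ?r x v)" for v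
    by (intro smooth_on_diff smooth_on_mult smooth_on_add U smooth_t sf smooth_on_D
        smooth_functions_local[OF xi_deriv_smooth[OF f] c])
  show "linear (?r x)" if x: "x \<in> chart_image c" for x
    using linear_add[OF linear_t[OF x]] linear_cmul[OF linear_t[OF x]]
      linear_add[OF linear_D[OF smooth_on_imp_differentiable[OF sf x]]]
      linear_cmul[OF linear_D[OF smooth_on_imp_differentiable[OF sf x]]]
    by (intro linearI) (simp_all add: algebra_simps)
  show "dform (lf c) x (ham f (chart_inv c x) c) v + lf c x (ham f (chart_inv c x) c) * lf c x v = ?r x v"
    if x: "x \<in> chart_image c" for x v
    using ham_chart[OF f charts_at_chart_inv[OF c x]] by (simp add: chart_map_inv[OF c x] algebra_simps)
qed

section \<open>The Jacobi bracket\<close>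

abbreviation jb :: "('a \<Rightarrow> real) \<Rightarrow> ('a \<Rightarrow> real) \<Rightarrow> 'a \<Rightarrow> real" where
  "jb \<equiv> jacobi_bracket A \<theta>"

text \<open>The functions are indexed by an arbitrary type so that the two functions of antisymmetry and the
  three of the Jacobi identity are covered alike.\<close>

lemma hamiltonian_data_chart:
  assumes c: "c \<in> A" and fs: "\<And>i. fs i \<in> smooth_functions A"
  shows "hamiltonian_data (chart_image c) (lf c) (\<lambda>i. fs i \<circ> chart_inv c)
    (\<lambda>i. xi_deriv (fs i) \<circ> chart_inv c) (\<lambda>i x. ham (fs i) (chart_inv c x) c)"
proof -
  interpret open_form "chart_image c" "lf c" by (rule open_form_lf[OF c])
  show ?thesis
  proof
    fix i x v assume x: "x \<in> chart_image c"
    show "lf c x (ham (fs i) (chart_inv c x) c) = (fs i \<circ> chart_inv c) x"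
      using ham_chart(1)[OF fs charts_at_chart_inv[OF c x]] by (simp add: chart_map_inv[OF c x])
    show "dform (lf c) x (ham (fs i) (chart_inv c x) c) v =
        (xi_deriv (fs i) \<circ> chart_inv c) x * lf c x v - D (fs i \<circ> chart_inv c) x v"
      using ham_chart(2)[OF fs charts_at_chart_inv[OF c x]] by (simp add: chart_map_inv[OF c x])
  qed (intro smooth_functions_local[OF fs c] smooth_functions_local[OF xi_deriv_smooth[OF fs] c]
      ham_smooth[OF fs c])+
qed

lemma jb_chart:
  assumes f: "f \<in> smooth_functions A" and g: "g \<in> smooth_functions A" and c: "c \<in> A" and x: "x \<in> chart_image c"
  shows "(jb f g \<circ> chart_inv c) x = D (g \<circ> chart_inv c) x (ham f (chart_inv c x) c)
    - (g \<circ> chart_inv c) x * (xi_deriv f \<circ> chart_inv c) x"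
  using dir_deriv_chart[OF g ham_in_tangent[OF f] charts_at_chart_inv[OF c x]]
  by (simp add: jacobi_bracket_def chart_map_inv[OF c x])

lemma jb_smooth:
  assumes f: "f \<in> smooth_functions A" and g: "g \<in> smooth_functions A"
  shows "jb f g \<in> smooth_functions A"
  unfolding smooth_functions_def
proof (intro CollectI ballI)
  fix c assume c: "c \<in> A"
  have "smooth_on (chart_image c) (\<lambda>x. D (g \<circ> chart_inv c) x (ham f (chart_inv c x) c)
    - (g \<circ> chart_inv c) x * (xi_deriv f \<circ> chart_inv c) x)"
    by (intro smooth_on_diff smooth_on_mult open_chart_image[OF c] smooth_functions_D_field[OF g c ham_smooth[OF f c]]
        smooth_functions_local[OF g c] smooth_functions_local[OF xi_deriv_smooth[OF f] c])
  then show "smooth_on (chart_image c) (jb f g \<circ> chart_inv c)"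
    by (subst smooth_on_cong[OF open_chart_image[OF c] jb_chart[OF f g c]])
qed

lemma jb_antisym:
  assumes f: "f \<in> smooth_functions A" and g: "g \<in> smooth_functions A"
  shows "jb f g p = - jb g f p"
proof -
  define c where "c = chart_at A p"
  have c: "c \<in> charts_at A p" unfolding c_def by (rule chart_at_in)
  note cA = charts_atD(1)[OF c] and x = chart_map_in[OF c]
  define fs where "fs i = (if i then f else g)" for i
  interpret hamiltonian_data "chart_image c" "lf c" "\<lambda>i. fs i \<circ> chart_inv c"
      "\<lambda>i. xi_deriv (fs i) \<circ> chart_inv c" "\<lambda>i x. ham (fs i) (chart_inv c x) c"
    by (rule hamiltonian_data_chart[OF cA]) (simp add: fs_def f g)
  show ?thesis
    using br_antisym[OF x, of True False, unfolded br_def] jb_chart[OF f g cA x] jb_chart[OF g f cA x]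
    by (simp add: fs_def chart_inv_map_at[OF c])
qed

lemma jb_jacobi:
  assumes f: "f \<in> smooth_functions A" and g: "g \<in> smooth_functions A" and h: "h \<in> smooth_functions A"
  shows "jb f (jb g h) p + jb g (jb h f) p + jb h (jb f g) p = 0"
proof -
  define c where "c = chart_at A p"
  have c: "c \<in> charts_at A p" unfolding c_def by (rule chart_at_in)
  note cA = charts_atD(1)[OF c] and x = chart_map_in[OF c]
  define fs where "fs i = (if i = 0 then f else if i = 1 then g else h)" for i :: nat
  have fs: "fs i \<in> smooth_functions A" for i by (simp add: fs_def f g h)
  interpret hamiltonian_data "chart_image c" "lf c" "\<lambda>i. fs i \<circ> chart_inv c"
      "\<lambda>i. xi_deriv (fs i) \<circ> chart_inv c" "\<lambda>i x. ham (fs i) (chart_inv c x) c"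
    by (rule hamiltonian_data_chart[OF cA fs])
  have br: "(jb (fs i) (fs j) \<circ> chart_inv c) y = br i j y" if "y \<in> chart_image c" for i j y
    using jb_chart[OF fs fs cA that] by (simp add: br_def)
  have "jb (fs i) (jb (fs j) (fs k)) p = D (br j k) (chart_map c p) (ham (fs i) p c)
      - br j k (chart_map c p) * xi_deriv (fs i) p" for i j k
  proof -
    have "D (jb (fs j) (fs k) \<circ> chart_inv c) (chart_map c p) = D (br j k) (chart_map c p)"
      by (rule D_cong_open[OF U x br])
    then show ?thesis
      using jb_chart[OF fs jb_smooth[OF fs fs] cA x, of i j k] br[OF x, of j k]
      by (simp add: chart_inv_map_at[OF c])
  qed
  note jb_br = this[of 0 1 2] this[of 1 2 0] this[of 2 0 1]
  have "jb (fs 0) (jb (fs 1) (fs 2)) p + jb (fs 1) (jb (fs 2) (fs 0)) p + jb (fs 2) (jb (fs 0) (fs 1)) p = 0"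
    using jacobi[OF x, of 1 2 0] unfolding jb_br by (simp only: o_apply chart_inv_map_at[OF c])
  then show ?thesis by (simp add: fs_def)
qed

lemma jb_add_right:
  assumes "g \<in> smooth_functions A" "h \<in> smooth_functions A"
  shows "jb f (g + h) = jb f g + jb f h"
  by (rule ext) (simp add: jacobi_bracket_def dir_deriv_add[OF assms] algebra_simps)

lemma jb_scale_right:
  assumes "g \<in> smooth_functions A"
  shows "jb f (fscale r g) = fscale r (jb f g)"
  by (rule ext) (simp add: jacobi_bracket_def dir_deriv_scale[OF assms] algebra_simps)

lemma jb_add_left:
  assumes f: "f \<in> smooth_functions A" and g: "g \<in> smooth_functions A" and h: "h \<in> smooth_functions A"
  shows "jb (f + g) h = jb f h + jb g h"
  using jb_antisym[OF smooth_functions_add[OF f g] h] jb_antisym[OF f h] jb_antisym[OF g h]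
  by (simp add: fun_eq_iff jb_add_right[OF f g])

lemma jb_scale_left:
  assumes f: "f \<in> smooth_functions A" and g: "g \<in> smooth_functions A"
  shows "jb (fscale r f) g = fscale r (jb f g)"
  using jb_antisym[OF smooth_functions_scale[OF f] g] jb_antisym[OF f g]
  by (simp add: fun_eq_iff jb_scale_right[OF f])

lemma module_fscale: "module (fscale :: real \<Rightarrow> ('b \<Rightarrow> real) \<Rightarrow> 'b \<Rightarrow> real)"
  by unfold_locales (auto simp: fun_eq_iff algebra_simps)

lemma function_spaceI:
  assumes "(\<lambda>x. 0) \<in> V" "\<And>f g. f \<in> V \<Longrightarrow> g \<in> V \<Longrightarrow> f + g \<in> V" "\<And>r f. f \<in> V \<Longrightarrow> fscale r f \<in> V"
  shows "function_space V"
  unfolding module.subspace_def[OF module_fscale] using assms by (auto simp: zero_fun_def)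

lemma lie_algebra_smooth: "lie_algebra (smooth_functions A) jb"
  unfolding lie_algebra_def
proof (intro conjI ballI allI)
  show "function_space (smooth_functions A)"
    by (intro function_spaceI smooth_functions_const smooth_functions_add smooth_functions_scale)
  fix f g h assume f: "f \<in> smooth_functions A" and g: "g \<in> smooth_functions A" and h: "h \<in> smooth_functions A"
  show "jb f (jb g h) + jb g (jb h f) + jb h (jb f g) = 0"
    using jb_jacobi[OF f g h] by (simp add: fun_eq_iff)
next
  fix f assume f: "f \<in> smooth_functions A"
  have "jb f f p = 0" for p using jb_antisym[OF f f, of p] by linarith
  then show "jb f f = 0" by (simp add: fun_eq_iff)
qed (simp_all only: jb_smooth jb_add_left jb_add_right jb_scale_left jb_scale_right)

lemma basicD:
  assumes "f \<in> basic_functions A \<theta>"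
  shows "f \<in> smooth_functions A" "xi_deriv f p = 0"
  using assms by (auto simp: basic_functions_def)

lemma function_algebra_basic: "function_algebra (basic_functions A \<theta>)"
  unfolding function_algebra_def
proof (intro conjI ballI function_spaceI)
  show "(\<lambda>x. 0) \<in> basic_functions A \<theta>" "1 \<in> basic_functions A \<theta>"
    by (auto simp: basic_functions_def smooth_functions_const dir_deriv_const one_fun_def)
qed (auto simp: basic_functions_def smooth_functions_add smooth_functions_mult smooth_functions_scale
    dir_deriv_add dir_deriv_mult dir_deriv_scale)

text \<open>The Reeb derivative is the bracket with the constant function \<open>1\<close>, so the Jacobi identity makes it a
  derivation of the bracket.\<close>

lemma jb_one: "f \<in> smooth_functions A \<Longrightarrow> jb (\<lambda>p. 1) f p = xi_deriv f p"
  using jb_antisym[OF smooth_functions_const[of 1], of f p] by (simp add: jacobi_bracket_def dir_deriv_const)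

text \<open>In the Jacobi identity for \<open>1\<close>, \<open>f\<close> and \<open>g\<close>, the brackets \<open>{1, f}\<close> and \<open>{g, 1}\<close> vanish.\<close>

lemma jb_basic:
  assumes f: "f \<in> basic_functions A \<theta>" and g: "g \<in> basic_functions A \<theta>"
  shows "jb f g \<in> basic_functions A \<theta>"
proof -
  note fs = basicD(1)[OF f] and gs = basicD(1)[OF g] and one = smooth_functions_const[of 1]
  have 1: "jb (\<lambda>p. 1) f = (\<lambda>p. 0)" by (rule ext) (simp add: jb_one[OF fs] basicD(2)[OF f])
  have 2: "jb g (\<lambda>p. 1) = (\<lambda>p. 0)"
    by (rule ext) (simp add: jb_antisym[OF gs one] jb_one[OF gs] basicD(2)[OF g])
  have 3: "jb h (\<lambda>p. 0) p = 0" for h p by (simp add: jacobi_bracket_def dir_deriv_const)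
  have "xi_deriv (jb f g) p = 0" for p
    using jb_jacobi[OF one fs gs, of p] by (simp add: 1 2 3 jb_one[OF jb_smooth[OF fs gs]])
  then show ?thesis by (simp add: basic_functions_def jb_smooth[OF fs gs])
qed

text \<open>When \<open>\<xi>f = 0\<close>, the bracket \<open>{f, g}\<close> is just the derivative \<open>X\<^sub>f g\<close>, which is a derivation in \<open>g\<close>.\<close>

lemma jb_mult_right:
  assumes f: "f \<in> basic_functions A \<theta>" and g: "g \<in> smooth_functions A" and h: "h \<in> smooth_functions A"
  shows "jb f (g * h) = jb f g * h + g * jb f h"
  by (rule ext) (simp add: jacobi_bracket_def dir_deriv_mult[OF g h] basicD(2)[OF f])

lemma jb_mult_left:
  assumes f: "f \<in> basic_functions A \<theta>" and g: "g \<in> basic_functions A \<theta>" and h: "h \<in> basic_functions A \<theta>"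
  shows "jb (f * g) h = jb f h * g + f * jb g h"
proof -
  note fs = basicD(1)[OF f] and gs = basicD(1)[OF g] and hs = basicD(1)[OF h]
  show ?thesis
    using jb_antisym[OF smooth_functions_mult[OF fs gs] hs] jb_antisym[OF fs hs] jb_antisym[OF gs hs]
    by (simp add: fun_eq_iff jb_mult_right[OF h fs gs])
qed

lemma lie_subalgebra_basic: "lie_subalgebra (basic_functions A \<theta>) (smooth_functions A) jb"
  using lie_algebra_smooth function_algebra_basic
  by (auto simp: lie_subalgebra_def function_algebra_def jb_basic basicD(1))

lemma lie_subalgebra_imp_lie_algebra: "lie_subalgebra S V br \<Longrightarrow> lie_algebra S br"
  by (simp add: lie_subalgebra_def lie_algebra_def subset_iff)

lemma poisson_basic: "poisson_bracket_on (basic_functions A \<theta>) jb"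
  unfolding poisson_bracket_on_def
  using function_algebra_basic lie_subalgebra_imp_lie_algebra[OF lie_subalgebra_basic]
  by (auto intro: jb_mult_left jb_mult_right basicD(1))

end

theorem proposition1p1:
  fixes A :: "('a::{t2_space, second_countable_topology}, real ^ 'm) chart set"
    and \<theta> :: "'a \<Rightarrow> ('a, real ^ 'm) tvec \<Rightarrow> real"
    and n :: nat
  assumes "smooth_atlas A"
    and "compact (UNIV :: 'a set)"
    and "CARD('m) = 2 * n + 1"
    and "contact_form n A \<theta>"
  shows "lie_subalgebra (basic_functions A \<theta>) (smooth_functions A) (jacobi_bracket A \<theta>)
    \<and> poisson_bracket_on (basic_functions A \<theta>) (jacobi_bracket A \<theta>)"
proof -
  interpret contact_manifold A \<theta> n by unfold_locales (use assms in auto)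
  show ?thesis using lie_subalgebra_basic poisson_basic by blast
qed

end
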